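(* Let $k$ be a field. Suppose $R$ and $S$ are $k$-algebras (which for notational simplicity are assumed disjoint except for the common subfield $k$), and let $p\in R-\{0\}$, $q\in S-\{0\}$ satisfy $$1\notin pR+Rp,\qquad 1\notin qS+Sq.$$ Let $B=B_{++}\cup B_{+-}\cup B_{-+}\cup B_{--}$, where $B_{++}$ is any $k$-basis of $pR\cap Rp$ containing $p$; $B_{+-}$ is any $k$-basis of $pR$ relative to $pR\cap Rp$; $B_{-+}$ is any $k$-basis of $Rp$ relative to $pR\cap Rp$; $B_{--}$ is any $k$-basis of $R$ relative to $pR+Rp+k$. Likewise let $C=C_{++}\cup C_{+-}\cup C_{-+}\cup C_{--}$, where $C_{++}$ is any $k$-basis of $qS\cap Sq$ containing $q$; $C_{+-}$ is any $k$-basis of $qS$ relative to $qS\cap Sq$; $C_{-+}$ is any $k$-basis of $Sq$ relative to $qS\cap Sq$; $C_{--}$ is any $k$-basis of $S$ relative to $qS+Sq+k$. (So $B\cup\{1\}$ is a $k$-basis of $R$ and $C\cup\{1\}$ is a $k$-basis of $S$.) Then the $k$-algebra $T$ freely generated by the two $k$-algebras $R$ and $S$, subject to the two additional relations $$pqp=p,\qquad qpq=q,$$ has a $k$-basis given by all words in $B\cup C$ which contain no subwords of any of the forms (i) $xy$ with $x,y\in B$; (ii) $(xp)\,q\,(py)$ with $xp\in B_{++}\cup B_{-+}$ and $py\in B_{++}\cup B_{+-}$; (iii) $xy$ with $x,y\in C$; (iv) $(xq)\,p\,(qy)$ with $xq\in C_{++}\cup C_{-+}$ and $qy\in C_{++}\cup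 C_{+-}$. The reduction to this normal form may be accomplished by the reductions $xy\mapsto (xy)_R$ for all $x,y\in B$; $(xp)\,q\,(py)\mapsto (xpy)_R$ for all $xp\in B_{++}\cup B_{-+}$, $py\in B_{++}\cup B_{+-}$; $xy\mapsto (xy)_S$ for all $x,y\in C$; and $(xq)\,p\,(qy)\mapsto (xqy)_S$ for all $xq\in C_{++}\cup C_{-+}$, $qy\in C_{++}\cup C_{+-}$.
   Context: All rings are associative with unit, and for a nonzero $k$-algebra the $k$-subspace spanned by $1$ is identified with $k$. If $U\subseteq V$ are $k$-vector spaces, a $k$-basis of $V$ relative to $U$ is a subset $B\subseteq V$ such that every element of $V$ can be written uniquely as the sum of an element of $U$ and a $k$-linear combination of elements of $B$. Elements of $B$ and $C$ are single letters. An element of $B_{++}\cup B_{-+}$ is written $(xp)$ with $x\in R$, an element of $B_{++}\cup B_{+-}$ is written $(py)$ with $y\in R$, an element of $C_{++}\cup C_{-+}$ is written $(xq)$ with $x\in S$, and an element of $C_{++}\cup C_{+-}$ is written $(qy)$ with $y\in S$; such $x,y$ need not be unique, but $xpy\in R$ (resp. $xqy\in S$) depends only on $xp,py$ (resp. $xq,qy$). For an expression $f$ representing an element of $R$ (resp. $S$), $f_R$ (resp. $f_S$) denotes the unique $k$-linear combination of elements of $B\cup\{1\}$ (resp. $C\cup\{1\}$) giving its value. Words and reductions: if an algebra $A$ is generated by a set $G$, a word is a member of the free monoid on $G$ inside the free algebra $k\langle G\rangle$ (the empty word is $1$). A family of words gives a $k$-basis of $A$ if it maps one-to-one into $A$ with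 image a $k$-basis of $A$. A reduction $W\mapsto f$ permits replacing any word $uWv$ occurring in an element of $k\langle G\rangle$ by $ufv$. That reduction to a normal form may be accomplished by a system of reductions means that the corresponding relations $W=f$ hold in $A$, and that, starting from any element of $k\langle G\rangle$, repeated application of the reductions terminates at the unique $k$-linear combination of words of the given basis having the same image in $A$. *)

theory Defs
  imports
    Complex_Main
    "HOL-Algebra.QuotRing"
    "HOL-Algebra.Module"
    "HOL-Library.Poly_Mapping"
    "HOL-Library.Set_Algebras"
    "HOL-Library.Sublist"
begin

section \<open>Algebras over a field and relative bases\<close>

text \<open>
  Associative unital algebras, not necessarily commutative.  The class \<open>ring_1\<close> makes them
  nonzero, so \<open>range (\<lambda>a. scale a 1)\<close> is a copy of the field.
\<close>

locale k_algebra = vector_space scale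
  for scale :: "'k::field \<Rightarrow> 'r::ring_1 \<Rightarrow> 'r" +
  assumes scale_mult_left: "scale a x * y = scale a (x * y)"
    and scale_mult_right: "x * scale a y = scale a (x * y)"

text \<open>
  \<open>B\<close> is a basis of \<open>V\<close> relative to \<open>U\<close>.  The elements of the type \<open>'v \<Rightarrow>\<^sub>0 'k\<close> are the
  coefficient families of finite support.  For \<open>U = {0}\<close> this is an ordinary basis of \<open>V\<close>.
\<close>

definition relative_basis ::
    "('k::field \<Rightarrow> 'v::ab_group_add \<Rightarrow> 'v) \<Rightarrow> 'v set \<Rightarrow> 'v set \<Rightarrow> 'v set \<Rightarrow> bool" where
  "relative_basis scale U V B \<longleftrightarrow>
     B \<subseteq> V \<and>
     (\<forall>v\<in>V. \<exists>!(u, c :: 'v \<Rightarrow>\<^sub>0 'k).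
        u \<in> U \<and> Poly_Mapping.keys c \<subseteq> B \<and>
        v = u + (\<Sum>b\<in>Poly_Mapping.keys c. scale (Poly_Mapping.lookup c b) b))"

definition right_multiples :: "'r::ring_1 \<Rightarrow> 'r set" where
  "right_multiples p = range (\<lambda>x. p * x)"

definition left_multiples :: "'r::ring_1 \<Rightarrow> 'r set" where
  "left_multiples p = range (\<lambda>x. x * p)"

definition scalars :: "('k::field \<Rightarrow> 'r::ring_1 \<Rightarrow> 'r) \<Rightarrow> 'r set" where
  "scalars scale = range (\<lambda>a. scale a 1)"

text \<open>The sums of subspaces below are those of \<open>HOL-Library.Set_Algebras\<close>.\<close>

definition adapted_basis ::
    "('k::field \<Rightarrow> 'r::ring_1 \<Rightarrow> 'r) \<Rightarrow> 'r \<Rightarrow> 'r set \<Rightarrow> 'r set \<Rightarrow> 'r set \<Rightarrow> 'r set \<Rightarrow> bool" where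
  "adapted_basis scale p Bpp Bpm Bmp Bmm \<longleftrightarrow>
     relative_basis scale {0} (right_multiples p \<inter> left_multiples p) Bpp \<and> p \<in> Bpp \<and>
     relative_basis scale (right_multiples p \<inter> left_multiples p) (right_multiples p) Bpm \<and>
     relative_basis scale (right_multiples p \<inter> left_multiples p) (left_multiples p) Bmp \<and>
     relative_basis scale (right_multiples p + left_multiples p + scalars scale) UNIV Bmm"


section \<open>Free algebras\<close>

text \<open>
  Lists under concatenation form the free monoid, so that the convolution product of
  \<open>HOL-Library.Poly_Mapping\<close> makes \<open>'g list \<Rightarrow>\<^sub>0 'k\<close> the free associative algebra on \<open>'g\<close>.
\<close>

instantiation list :: (type) monoid_add
begin

definition zero_list :: "'a list" where "zero_list = []"

definition plus_list :: "'a list \<Rightarrow> 'a list \<Rightarrow> 'a list" where "plus_list = append"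

instance
  by standard (simp_all add: zero_list_def plus_list_def)

end

type_synonym ('g, 'k) free_alg = "'g list \<Rightarrow>\<^sub>0 'k"

definition word :: "'g list \<Rightarrow> ('g, 'k::field) free_alg" where
  "word w = Poly_Mapping.single w 1"

definition fscale :: "'k::field \<Rightarrow> ('g, 'k) free_alg \<Rightarrow> ('g, 'k) free_alg" where
  "fscale a f = Poly_Mapping.single [] a * f"

definition free_algebra :: "('k::field, ('g, 'k) free_alg) module" where
  "free_algebra =
     \<lparr>carrier = UNIV, mult = times, one = 1, zero = 0, add = plus, smult = fscale\<rparr>"

text \<open>The subalgebra generated by a set \<open>G\<close> of letters.\<close>

definition free_on :: "'g set \<Rightarrow> ('g, 'k::field) free_alg set" where
  "free_on G = {f. Poly_Mapping.keys f \<subseteq> lists G}"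


section \<open>Quotient algebras and their bases\<close>

text \<open>The quotient ring \<open>A Quot I\<close>, together with the induced scalar multiplication.\<close>

definition quotient_algebra ::
    "('k, 'a) module \<Rightarrow> 'a set \<Rightarrow> ('k, 'a set) module" where
  "quotient_algebra A I =
     ring.extend (A Quot I) (module.fields (\<lambda>a X. \<Union>x\<in>X. I +>\<^bsub>A\<^esub> (a \<odot>\<^bsub>A\<^esub> x)))"

definition is_basis :: "('k::field, 'v) module \<Rightarrow> 'v set \<Rightarrow> bool" where
  "is_basis M E \<longleftrightarrow>
     E \<subseteq> carrier M \<and>
     (\<forall>v\<in>carrier M. \<exists>!c :: 'v \<Rightarrow>\<^sub>0 'k.
        Poly_Mapping.keys c \<subseteq> E \<and>
        v = (\<Oplus>\<^bsub>M\<^esub>e\<in>Poly_Mapping.keys c. Poly_Mapping.lookup c e \<odot>\<^bsub>M\<^esub> e))"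


section \<open>The algebra with a universal pair of mutual inner inverses\<close>

text \<open>
  The algebra is presented on the disjoint union \<open>'r + 's\<close> of all elements of the two given
  algebras.  The relations for one of them, along an injection \<open>\<iota>\<close> into the set of generators, are
  the following; in particular both units are identified with the empty word.
\<close>

definition algebra_relations ::
    "('k::field \<Rightarrow> 'r::ring_1 \<Rightarrow> 'r) \<Rightarrow> ('r \<Rightarrow> 'g) \<Rightarrow> ('g, 'k) free_alg set" where
  "algebra_relations scale \<iota> =
     {word [\<iota> (x + y)] - (word [\<iota> x] + word [\<iota> y]) | x y. True} \<union>
     {word [\<iota> (scale a x)] - fscale a (word [\<iota> x]) | a x. True} \<union>
     {word [\<iota> (x * y)] - word [\<iota> x] * word [\<iota> y] | x y. True} \<union>
     {word [\<iota> 1] - 1}"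

definition T_ideal ::
    "('k::field \<Rightarrow> 'r::ring_1 \<Rightarrow> 'r) \<Rightarrow> ('k \<Rightarrow> 's::ring_1 \<Rightarrow> 's) \<Rightarrow> 'r \<Rightarrow> 's \<Rightarrow>
      ('r + 's, 'k) free_alg set" where
  "T_ideal scR scS p q =
     Idl\<^bsub>free_algebra\<^esub>
       (algebra_relations scR Inl \<union> algebra_relations scS Inr \<union>
        {word [Inl p] * word [Inr q] * word [Inl p] - word [Inl p],
         word [Inr q] * word [Inl p] * word [Inr q] - word [Inr q]})"

definition T_algebra ::
    "('k::field \<Rightarrow> 'r::ring_1 \<Rightarrow> 'r) \<Rightarrow> ('k \<Rightarrow> 's::ring_1 \<Rightarrow> 's) \<Rightarrow> 'r \<Rightarrow> 's \<Rightarrow>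
      ('k, ('r + 's, 'k) free_alg set) module" where
  "T_algebra scR scS p q =
     quotient_algebra free_algebra (T_ideal scR scS p q)"

definition T_map ::
    "('k::field \<Rightarrow> 'r::ring_1 \<Rightarrow> 'r) \<Rightarrow> ('k \<Rightarrow> 's::ring_1 \<Rightarrow> 's) \<Rightarrow> 'r \<Rightarrow> 's \<Rightarrow>
      ('r + 's, 'k) free_alg \<Rightarrow> ('r + 's, 'k) free_alg set" where
  "T_map scR scS p q f = T_ideal scR scS p q +>\<^bsub>free_algebra\<^esub> f"


section \<open>Normal forms and reductions\<close>

text \<open>
  The element \<open>r\<close> written as a linear combination of \<open>B \<union> {1}\<close>, with \<open>b \<in> B\<close> regarded as
  the one-letter word \<open>[\<iota> b]\<close> and \<open>1\<close> as the empty word.  This requires \<open>B \<union> {1}\<close>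
  to be a basis; otherwise \<open>representation\<close> may be \<open>0\<close>.
\<close>

definition expand ::
    "('k::field \<Rightarrow> 'r::ring_1 \<Rightarrow> 'r) \<Rightarrow> ('r \<Rightarrow> 'g) \<Rightarrow> 'r set \<Rightarrow> 'r \<Rightarrow> ('g, 'k) free_alg" where
  "expand scale \<iota> B r =
     (let c = module.representation scale (insert 1 B) r
      in \<Sum>b | c b \<noteq> 0. Poly_Mapping.single (if b = 1 then [] else [\<iota> b]) (c b))"

text \<open>
  Each of the next two definitions covers one half of the picture: \<open>\<iota>\<close> embeds the letters of
  the algebra containing \<open>p\<close>, and \<open>q'\<close> is the letter of the other algebra standing for its
  distinguished element.
\<close>

definition forbidden ::
    "('r \<Rightarrow> 'g) \<Rightarrow> 'g \<Rightarrow> 'r set \<Rightarrow> 'r set \<Rightarrow> 'r set \<Rightarrow> 'r set \<Rightarrow> 'g list set" where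
  "forbidden \<iota> q' Bpp Bpm Bmp Bmm =
     (let B = Bpp \<union> Bpm \<union> Bmp \<union> Bmm in
      {[\<iota> x, \<iota> y] | x y. x \<in> B \<and> y \<in> B} \<union>
      {[\<iota> u, q', \<iota> v] | u v. u \<in> Bpp \<union> Bmp \<and> v \<in> Bpp \<union> Bpm})"

definition reductions ::
    "('k::field \<Rightarrow> 'r::ring_1 \<Rightarrow> 'r) \<Rightarrow> ('r \<Rightarrow> 'g) \<Rightarrow> 'r \<Rightarrow> 'g \<Rightarrow>
      'r set \<Rightarrow> 'r set \<Rightarrow> 'r set \<Rightarrow> 'r set \<Rightarrow> ('g list \<times> ('g, 'k) free_alg) set" where
  "reductions scale \<iota> p q' Bpp Bpm Bmp Bmm =
     (let B = Bpp \<union> Bpm \<union> Bmp \<union> Bmm in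
      {([\<iota> x, \<iota> y], expand scale \<iota> B (x * y)) | x y. x \<in> B \<and> y \<in> B} \<union>
      {([\<iota> (x * p), q', \<iota> (p * y)], expand scale \<iota> B (x * p * y)) | x y.
         x * p \<in> Bpp \<union> Bmp \<and> p * y \<in> Bpp \<union> Bpm})"

definition normal_words :: "'g set \<Rightarrow> 'g list set \<Rightarrow> 'g list set" where
  "normal_words G F = {w \<in> lists G. \<not> (\<exists>W\<in>F. sublist W w)}"

text \<open>
  A single reduction step replaces one occurrence of the left-hand side of a reduction in one
  word occurring with nonzero coefficient.
\<close>

definition red_step ::
    "('g list \<times> ('g, 'k::field) free_alg) set \<Rightarrow> ('g, 'k) free_alg \<Rightarrow> ('g, 'k) free_alg \<Rightarrow> bool" where
  "red_step \<Sigma> f g \<longleftrightarrow>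
     (\<exists>(W, h)\<in>\<Sigma>. \<exists>u v.
        u @ W @ v \<in> Poly_Mapping.keys f \<and>
        (let c = Poly_Mapping.lookup f (u @ W @ v)
         in g = f - fscale c (word (u @ W @ v)) + fscale c (word u * h * word v)))"

text \<open>
  Here \<open>\<pi>\<close> is the map from the free algebra to the algebra under consideration, \<open>G\<close> is the
  set of generators and \<open>N\<close> the set of basis words.  Every sequence of reduction steps is finite,
  and whichever steps are chosen, the result is the unique normal form.
\<close>

definition reduces_to_normal_form ::
    "(('g, 'k::field) free_alg \<Rightarrow> 't) \<Rightarrow> 'g set \<Rightarrow> 'g list set \<Rightarrow>
      ('g list \<times> ('g, 'k) free_alg) set \<Rightarrow> bool" where
  "reduces_to_normal_form \<pi> G N \<Sigma> \<longleftrightarrow>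
     (\<forall>(W, h)\<in>\<Sigma>. \<pi> (word W) = \<pi> h) \<and>
     (\<forall>f\<in>free_on G.
        \<not> (\<exists>F. F 0 = f \<and> (\<forall>i::nat. red_step \<Sigma> (F i) (F (Suc i)))) \<and>
        (\<exists>!g. Poly_Mapping.keys g \<subseteq> N \<and> \<pi> g = \<pi> f) \<and>
        (\<forall>h. (red_step \<Sigma>)\<^sup>*\<^sup>* f h \<and> \<not> (\<exists>h'. red_step \<Sigma> h h') \<longrightarrow>
             Poly_Mapping.keys h \<subseteq> N \<and> \<pi> h = \<pi> f))"

end

theory Submission
  imports Defs "HOL-Library.Multiset"
begin

text \<open>
  All reductions replace a word by a combination of shorter words, so they terminate, and by
  Bergman's diamond lemma they are confluent once every overlap of two left-hand sides resolves.
  Overlaps within one factor resolve by associativity, because \<open>pR\<close> and \<open>Rp\<close> are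
  spanned by \<open>B\<^sub>+\<^sub>+ \<union> B\<^sub>+\<^sub>-\<close> and
  \<open>B\<^sub>+\<^sub>+ \<union> B\<^sub>-\<^sub>+\<close>; the two factors only interact through
  \<open>(xp) q p (qy)\<close> and its mirror image.  Thus taking normal forms is a linear map that vanishes on
  the ideal generated by the reductions; composed with the expansion of all elements of
  \<open>R\<close> and \<open>S\<close> in the two bases, it vanishes on the defining ideal of \<open>T\<close> and fixes
  the normal words, which are therefore independent.
\<close>

section \<open>Free algebras\<close>

text \<open>The shape of the basis is dictated by one kind of overlap. When (xp) q (py) is followed
  by a letter z, the product (py) z is replaced by an expansion to which the inner reduction must
  apply term by term. So elements of pR have to expand in letters from pR alone, and symmetrically
  for Rp; one basis serves both subspaces if it is built upwards from their intersection. As 1 lies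
  outside pR + Rp, it stays independent of these letters and can become the empty word. Having p
  itself as a letter turns pqp = p into a single reduction. A second obstacle is that
  \<open>T\<close> is presented on all elements of R and S, while the reductions know only basis
  letters, so normal forms alone do not see the defining relations. Substituting expansions for
  generators bridges the gap: it is multiplicative, whereas taking normal forms is merely
  linear.\<close>

lemma lookup_fscale [simp]: "Poly_Mapping.lookup (fscale a f) w = a * Poly_Mapping.lookup f w"
proof -
  have "fscale a f = Poly_Mapping.map ((*) a) f"
    by (simp add: fscale_def mult_map_scale_conv_mult zero_list_def)
  then show ?thesis
    by (simp add: Poly_Mapping.map.rep_eq when_def)
qed

lemma lookup_word: "Poly_Mapping.lookup (word w) v = (if w = v then 1 else 0)"
  by (simp add: word_def lookup_single when_def)

lemma keys_word [simp]: "Poly_Mapping.keys (word w :: ('g, 'k::field) free_alg) = {w}"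
  by (simp add: word_def)

lemma keys_fscale: "Poly_Mapping.keys (fscale a f) \<subseteq> Poly_Mapping.keys f"
  by (auto simp: in_keys_iff)

lemma word_Nil: "word [] = 1"
  by (simp add: word_def flip: zero_list_def)

lemma word_append: "word (u @ v) = word u * word v"
  by (simp add: word_def mult_single plus_list_def)

lemma fscale_mult_left: "fscale a f * g = fscale a (f * g)"
  by (simp add: fscale_def mult.assoc)

lemma fscale_word: "fscale a (word w) = Poly_Mapping.single w a"
  by (rule poly_mapping_eqI) (simp add: lookup_word lookup_single when_def)

interpretation free_alg: vector_space "fscale :: 'k::field \<Rightarrow> ('g, 'k) free_alg \<Rightarrow> _"
  by standard (auto intro!: poly_mapping_eqI simp: lookup_add algebra_simps)

lemma keys_diff_subset:
  "Poly_Mapping.keys f \<subseteq> A \<Longrightarrow> Poly_Mapping.keys g \<subseteq> A \<Longrightarrow>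
   Poly_Mapping.keys (f - g :: 'a \<Rightarrow>\<^sub>0 'b::ab_group_add) \<subseteq> A"
  using keys_diff[of f g] by blast

lemma subspace_keys: "free_alg.subspace {f. Poly_Mapping.keys f \<subseteq> A}"
  by (rule free_alg.subspaceI) (auto dest!: subsetD[OF keys_add] subsetD[OF keys_fscale])

lemma free_alg_expansion:
  "f = (\<Sum>w\<in>Poly_Mapping.keys f. fscale (Poly_Mapping.lookup f w) (word w))"
  by (rule poly_mapping_eqI) (simp add: lookup_sum lookup_word in_keys_iff if_distrib cong: if_cong)

lemma free_alg_span_words:
  assumes "Poly_Mapping.keys f \<subseteq> A"
  shows "f \<in> free_alg.span (word ` A)"
  by (subst free_alg_expansion) (intro free_alg.span_sum free_alg.span_scale free_alg.span_base imageI subsetD[OF assms])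

lemma free_alg_keys_induct [consumes 1, case_names word add scale zero]:
  assumes "Poly_Mapping.keys f \<subseteq> A" and "\<And>w. w \<in> A \<Longrightarrow> P (word w)"
    and "\<And>f g. P f \<Longrightarrow> P g \<Longrightarrow> P (f + g)" and "\<And>a f. P f \<Longrightarrow> P (fscale a f)" and "P 0"
  shows "P f"
  using free_alg_span_words[OF assms(1)]
  by (induction rule: free_alg.span_induct_alt) (use assms in auto)

lemmas free_alg_induct [case_names word add scale zero] =
  free_alg_keys_induct[where A = UNIV, OF subset_UNIV, simplified]

text \<open>\<open>fscale\<close> is left multiplication by a constant, so the point is that
  constants are central; by linearity this is checked on words.\<close>

lemma fscale_mult_right: "f * fscale a g = fscale a (f * g :: ('g, 'k::field) free_alg)"
proof -
  have "f * Poly_Mapping.single [] a = Poly_Mapping.single [] a * f"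
  proof (induction f rule: free_alg_induct)
    case (word w)
    show ?case by (simp add: word_def mult_single plus_list_def)
  next
    case (scale b f)
    have "fscale b f * Poly_Mapping.single [] a = fscale b (f * Poly_Mapping.single [] a)"
      by (rule fscale_mult_left)
    also have "\<dots> = fscale b (fscale a f)"
      by (simp only: scale fscale_def)
    also have "\<dots> = fscale a (fscale b f)"
      by (rule free_alg.scale_left_commute)
    finally show ?case
      by (simp only: fscale_def)
  qed (simp_all add: distrib_left distrib_right)
  then show ?thesis
    by (simp add: fscale_def flip: mult.assoc)
qed

lemma keys_mult_subset:
  assumes "w \<in> Poly_Mapping.keys (f * g :: ('g, 'k::field) free_alg)"
  obtains u v where "u \<in> Poly_Mapping.keys f" "v \<in> Poly_Mapping.keys g" "w = u @ v"
  using assms keys_mult[of f g] by (auto simp: plus_list_def)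

lemma word_inject: "word u = (word v :: ('g, 'k::field) free_alg) \<longleftrightarrow> u = v"
  by (metis keys_word singleton_inject)

lemma keys_mult_lists:
  fixes f g :: "('g, 'k::field) free_alg"
  assumes "Poly_Mapping.keys f \<subseteq> lists A" "Poly_Mapping.keys g \<subseteq> lists A"
  shows "Poly_Mapping.keys (f * g) \<subseteq> lists A"
proof
  fix w assume "w \<in> Poly_Mapping.keys (f * g)"
  then obtain u v where "u \<in> Poly_Mapping.keys f" "v \<in> Poly_Mapping.keys g" "w = u @ v"
    by (rule keys_mult_subset)
  then have "u \<in> lists A" "v \<in> lists A" using assms by blast+
  then show "w \<in> lists A" unfolding \<open>w = _\<close> append_in_lists_conv by blast
qed

section \<open>Linear extension of maps given on words\<close>

definition lin :: "('g list \<Rightarrow> ('h, 'k::field) free_alg) \<Rightarrow> ('g, 'k) free_alg \<Rightarrow> ('h, 'k) free_alg" where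
  "lin \<phi> f = (\<Sum>w\<in>Poly_Mapping.keys f. fscale (Poly_Mapping.lookup f w) (\<phi> w))"

lemma lin_superset:
  assumes "finite A" "Poly_Mapping.keys f \<subseteq> A"
  shows "lin \<phi> f = (\<Sum>w\<in>A. fscale (Poly_Mapping.lookup f w) (\<phi> w))"
  unfolding lin_def using assms
  by (intro sum.mono_neutral_left) (auto simp: in_keys_iff)

lemma lin_add [simp]: "lin \<phi> (f + g) = lin \<phi> f + lin \<phi> g"
proof -
  let ?A = "Poly_Mapping.keys f \<union> Poly_Mapping.keys g"
  have "Poly_Mapping.keys (f + g) \<subseteq> ?A"
    by (rule keys_add)
  then show ?thesis
    by (simp add: lin_superset[of ?A] lookup_add free_alg.scale_left_distrib sum.distrib)
qed

lemma lin_scale [simp]: "lin \<phi> (fscale a f) = fscale a (lin \<phi> f)"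
  using keys_fscale[of a f]
  by (simp add: lin_superset[of "Poly_Mapping.keys f"] free_alg.scale_sum_right)

lemma lin_word [simp]: "lin \<phi> (word w) = \<phi> w"
  by (simp add: lin_def lookup_word)

lemma lin_zero [simp]: "lin \<phi> 0 = 0"
  by (simp add: lin_def)

lemma lin_diff [simp]: "lin \<phi> (f - g) = lin \<phi> f - lin \<phi> g"
  using lin_add[of \<phi> "f - g" g] by (simp add: algebra_simps)

lemma lin_one [simp]: "lin \<phi> 1 = \<phi> []"
  by (simp flip: word_Nil)

lemma keys_lin:
  assumes "\<And>w. w \<in> Poly_Mapping.keys f \<Longrightarrow> Poly_Mapping.keys (\<phi> w) \<subseteq> A"
  shows "Poly_Mapping.keys (lin \<phi> f) \<subseteq> A"
proof -
  have "lin \<phi> f \<in> {f. Poly_Mapping.keys f \<subseteq> A}"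
    unfolding lin_def using assms
    by (intro free_alg.subspace_sum[OF subspace_keys] free_alg.subspace_scale[OF subspace_keys]) auto
  then show ?thesis by simp
qed

section \<open>Length-reducing systems of reductions\<close>

text \<open>The condition \<open>P\<close> is imposed on the word in which the left-hand side is
  located. With a bound on the length, the span is the part of the reduction ideal visible below a
  given word, as in Bergman's resolvability relative to an ordering.\<close>

definition relators :: "('g list \<times> ('g, 'k::field) free_alg) set \<Rightarrow> ('g list \<Rightarrow> bool) \<Rightarrow> ('g, 'k) free_alg set" where
  "relators \<Sigma> P = {word u * (word W - h) * word v | u W h v. (W, h) \<in> \<Sigma> \<and> P (u @ W @ v)}"

abbreviation rel_below :: "('g list \<times> ('g, 'k::field) free_alg) set \<Rightarrow> nat \<Rightarrow> ('g, 'k) free_alg set" where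
  "rel_below \<Sigma> n \<equiv> free_alg.span (relators \<Sigma> (\<lambda>w. length w < n))"

lemma rel_below_mono: "\<Sigma> \<subseteq> \<Sigma>' \<Longrightarrow> m \<le> n \<Longrightarrow> rel_below \<Sigma> m \<subseteq> rel_below \<Sigma>' n"
  by (intro free_alg.span_mono) (fastforce simp: relators_def)

lemma rel_below_relator:
  assumes "(W, h) \<in> \<Sigma>" "length u + length W + length v < n"
  shows "word u * (word W - h) * word v \<in> rel_below \<Sigma> n"
  using assms by (intro free_alg.span_base) (fastforce simp: relators_def)

text \<open>Carries a resolved overlap into the surrounding word; the bound grows by exactly the
  length of the context.\<close>

lemma rel_below_context:
  assumes "f \<in> rel_below \<Sigma> n"
  shows "word a * f * word b \<in> rel_below \<Sigma> (n + length a + length b)"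
  using assms
proof (induction rule: free_alg.span_induct_alt)
  case base
  then show ?case by (simp add: free_alg.span_zero)
next
  case (step c x y)
  then obtain u W h v where "(W, h) \<in> \<Sigma>" "length (u @ W @ v) < n" "x = word u * (word W - h) * word v"
    by (auto simp: relators_def)
  then have "word (a @ u) * (word W - h) * word (v @ b) \<in> rel_below \<Sigma> (n + length a + length b)"
    by (intro rel_below_relator) auto
  then have "word a * x * word b \<in> rel_below \<Sigma> (n + length a + length b)"
    by (simp add: \<open>x = _\<close> word_append mult.assoc)
  then show ?case
    using step by (simp add: distrib_left distrib_right fscale_mult_left fscale_mult_right
        free_alg.span_add free_alg.span_scale)
qed

text \<open>For the case where a neighbouring left-hand side has already been replaced, so that the
  left context is a polynomial. The bound is required of every word in its support.\<close>

lemma rel_below_relator_left: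
  fixes f :: "('g, 'k::field) free_alg"
  assumes "(W, h) \<in> \<Sigma>" "\<And>u. u \<in> Poly_Mapping.keys f \<Longrightarrow> length u + length W + length v < n"
  shows "f * (word W - h) * word v \<in> rel_below \<Sigma> n"
proof -
  have "Poly_Mapping.keys f \<subseteq> {u. length u + length W + length v < n}" using assms(2) by blast
  then show ?thesis
    by (induction f rule: free_alg_keys_induct)
     (auto simp: distrib_right fscale_mult_left free_alg.span_add free_alg.span_scale
       free_alg.span_zero intro: rel_below_relator[OF assms(1)])
qed

lemma rel_below_relator_right:
  fixes f :: "('g, 'k::field) free_alg"
  assumes "(W, h) \<in> \<Sigma>" "\<And>v. v \<in> Poly_Mapping.keys f \<Longrightarrow> length u + length W + length v < n"
  shows "word u * (word W - h) * f \<in> rel_below \<Sigma> n"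
proof -
  have "Poly_Mapping.keys f \<subseteq> {v. length u + length W + length v < n}" using assms(2) by blast
  then show ?thesis
    by (induction f rule: free_alg_keys_induct)
     (auto simp: distrib_left fscale_mult_right free_alg.span_add free_alg.span_scale
       free_alg.span_zero intro: rel_below_relator[OF assms(1)])
qed

text \<open>
  Since right-hand sides only contain words shorter than the left-hand side, Bergman's diamond
  lemma can be run by induction on length, without a separate term order.
\<close>

definition irreducible :: "('g list \<times> ('g, 'k::field) free_alg) set \<Rightarrow> 'g list \<Rightarrow> bool" where
  "irreducible \<Sigma> w \<longleftrightarrow> \<not> (\<exists>W\<in>fst ` \<Sigma>. sublist W w)"

definition rewrites_to :: "('g list \<times> ('g, 'k::field) free_alg) set \<Rightarrow> 'g list \<Rightarrow> ('g, 'k) free_alg \<Rightarrow> bool" where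
  "rewrites_to \<Sigma> w f \<longleftrightarrow> (\<exists>(W, h)\<in>\<Sigma>. \<exists>u v. w = u @ W @ v \<and> f = word u * h * word v)"

lemma rewrites_toI: "(W, h) \<in> \<Sigma> \<Longrightarrow> rewrites_to \<Sigma> (u @ W @ v) (word u * h * word v)"
  unfolding rewrites_to_def by blast

lemma not_irreducible_iff: "\<not> irreducible \<Sigma> w \<longleftrightarrow> (\<exists>f. rewrites_to \<Sigma> w f)"
  by (fastforce simp: irreducible_def rewrites_to_def sublist_def)

locale length_reducing =
  fixes \<Sigma> :: "('g list \<times> ('g, 'k::field) free_alg) set"
  assumes shorter: "(W, h) \<in> \<Sigma> \<Longrightarrow> w \<in> Poly_Mapping.keys h \<Longrightarrow> length w < length W"
begin

lemma rewrites_shorter: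
  assumes "rewrites_to \<Sigma> w f" "m \<in> Poly_Mapping.keys f"
  shows "length m < length w"
  using assms shorter by (fastforce simp: rewrites_to_def elim!: keys_mult_subset)

text \<open>In this form a step subtracts a multiple of a relator, which makes its effect modulo an
  ideal immediate.\<close>

lemma red_step_iff:
  "red_step \<Sigma> f g \<longleftrightarrow>
     (\<exists>w h. w \<in> Poly_Mapping.keys f \<and> rewrites_to \<Sigma> w h \<and>
       g = f - fscale (Poly_Mapping.lookup f w) (word w - h))"
proof -
  have "f - fscale c x + fscale c y = f - fscale c (x - y)" for c and x y :: "('g, 'k) free_alg"
    by (simp add: free_alg.scale_right_diff_distrib)
  note eq = this
  show ?thesis (is "_ \<longleftrightarrow> ?R")
  proof
    assume "red_step \<Sigma> f g"
    then obtain W h u v where "(W, h) \<in> \<Sigma>" "u @ W @ v \<in> Poly_Mapping.keys f"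
      "g = f - fscale (Poly_Mapping.lookup f (u @ W @ v)) (word (u @ W @ v) - word u * h * word v)"
      unfolding red_step_def Let_def eq by blast
    then show ?R using rewrites_toI by blast
  next
    assume ?R
    then show "red_step \<Sigma> f g"
      unfolding red_step_def rewrites_to_def Let_def eq by blast
  qed
qed

text \<open>Termination measure: a step may create many words, but all are shorter than the one it
  removes, so the multiset of lengths drops in the multiset order.\<close>

definition key_lengths :: "('g, 'k) free_alg \<Rightarrow> nat multiset" where
  "key_lengths f = image_mset length (mset_set (Poly_Mapping.keys f))"

lemma red_step_decreases:
  assumes "red_step \<Sigma> f g"
  shows "(key_lengths g, key_lengths f) \<in> mult less_than"
proof -
  obtain w h where w: "w \<in> Poly_Mapping.keys f" and h: "rewrites_to \<Sigma> w h"
    and g: "g = f - fscale (Poly_Mapping.lookup f w) (word w - h)"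
    using assms unfolding red_step_iff by blast
  have wh: "w \<notin> Poly_Mapping.keys h"
    using rewrites_shorter[OF h] by blast
  \<comment> \<open>\<open>A\<close> holds the old words other than \<open>w\<close> that survive.
    \<open>D\<close> holds the new words, all of which come from \<open>h\<close>; \<open>E\<close>
    contains \<open>w\<close>, and also any old words whose coefficients happen to cancel.\<close>
  define A where "A = Poly_Mapping.keys g \<inter> (Poly_Mapping.keys f - {w})"
  define D where "D = Poly_Mapping.keys g - A"
  define E where "E = Poly_Mapping.keys f - A"
  have D: "x \<in> Poly_Mapping.keys h" if "x \<in> D" for x
  proof (rule ccontr)
    assume "x \<notin> Poly_Mapping.keys h"
    then show False
      using that w wh by (auto simp: D_def A_def g in_keys_iff lookup_minus lookup_word split: if_splits)
  qed
  have "mset_set (Poly_Mapping.keys g) = mset_set A + mset_set D"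
    by (subst mset_set_Union[symmetric]) (auto simp: A_def D_def intro: arg_cong[where f = mset_set])
  moreover have "mset_set (Poly_Mapping.keys f) = mset_set A + mset_set E"
    by (subst mset_set_Union[symmetric]) (auto simp: A_def E_def intro: arg_cong[where f = mset_set])
  moreover have "(image_mset length (mset_set A) + image_mset length (mset_set D),
      image_mset length (mset_set A) + image_mset length (mset_set E)) \<in> mult less_than"
  proof (rule one_step_implies_mult)
    have wE: "w \<in> E" using w by (simp add: E_def A_def)
    have fin: "finite E" "finite D" by (simp_all add: E_def D_def)
    show "image_mset length (mset_set E) \<noteq> {#}"
      using wE fin by (auto simp: mset_set_empty_iff)
    show "\<forall>k\<in>#image_mset length (mset_set D). \<exists>j\<in>#image_mset length (mset_set E). (k, j) \<in> less_than"
      using fin wE rewrites_shorter[OF h] D by fastforce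
  qed
  ultimately show ?thesis
    by (simp add: key_lengths_def)
qed

lemma red_step_terminates: "\<not> (\<exists>F. F 0 = f \<and> (\<forall>i::nat. red_step \<Sigma> (F i) (F (Suc i))))"
proof
  assume "\<exists>F. F 0 = f \<and> (\<forall>i::nat. red_step \<Sigma> (F i) (F (Suc i)))"
  then obtain F where "\<And>i::nat. red_step \<Sigma> (F i) (F (Suc i))" by blast
  then have "\<forall>i. (key_lengths (F (Suc i)), key_lengths (F i)) \<in> mult less_than"
    using red_step_decreases by blast
  moreover have "wf (mult less_than)" by (simp add: wf_mult)
  ultimately show False
    by (auto simp: wf_iff_no_infinite_down_chain)
qed

text \<open>An arbitrary fixed choice, which makes the normal form a function before confluence is
  known; \<open>nf_rewrites\<close> later removes the dependence on it.\<close>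

definition rewrite :: "'g list \<Rightarrow> ('g, 'k) free_alg" where
  "rewrite w = (SOME f. rewrites_to \<Sigma> w f)"

lemma rewrites_rewrite: "\<not> irreducible \<Sigma> w \<Longrightarrow> rewrites_to \<Sigma> w (rewrite w)"
  unfolding not_irreducible_iff rewrite_def by (rule someI_ex)

text \<open>The sum is \<open>lin nf_word (rewrite w)\<close> written out, so that each recursive
  call carries the membership of \<open>m\<close> in the support, on which termination
  rests.\<close>

function nf_word :: "'g list \<Rightarrow> ('g, 'k) free_alg" where
  "nf_word w = (if irreducible \<Sigma> w then word w else
     (\<Sum>m\<in>Poly_Mapping.keys (rewrite w). fscale (Poly_Mapping.lookup (rewrite w) m) (nf_word m)))"
  by auto
termination
  by (relation "measure length") (auto intro: rewrites_shorter[OF rewrites_rewrite])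

declare nf_word.simps [simp del]

abbreviation nf :: "('g, 'k) free_alg \<Rightarrow> ('g, 'k) free_alg" where
  "nf \<equiv> lin nf_word"

lemma nf_word_irreducible: "irreducible \<Sigma> w \<Longrightarrow> nf_word w = word w"
  by (simp add: nf_word.simps)

lemma nf_word_reducible: "\<not> irreducible \<Sigma> w \<Longrightarrow> nf_word w = nf (rewrite w)"
  by (simp add: nf_word.simps[of w] lin_def)

lemma nf_irreducible:
  assumes "Poly_Mapping.keys f \<subseteq> {w. irreducible \<Sigma> w}"
  shows "nf f = f"
  using assms by (subst (2) free_alg_expansion) (auto simp: lin_def nf_word_irreducible intro!: sum.cong)

lemma keys_nf: "Poly_Mapping.keys (nf f) \<subseteq> {w. irreducible \<Sigma> w}"
proof -
  have "Poly_Mapping.keys (nf_word w) \<subseteq> {w. irreducible \<Sigma> w}" for w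
  proof (induction w rule: length_induct)
    case (1 w)
    show ?case
    proof (cases "irreducible \<Sigma> w")
      case False
      then show ?thesis
        unfolding nf_word_reducible[OF False]
        using 1 rewrites_shorter[OF rewrites_rewrite[OF False]] by (intro keys_lin) blast
    qed (simp add: nf_word_irreducible)
  qed
  then show ?thesis by (intro keys_lin)
qed

text \<open>Transfers invariants of single rewrites to normal forms. Both are proved together
  because the congruence is only assumed for words of \<open>A\<close>, so the recursion has to stay
  inside \<open>A\<close>. Later \<open>A\<close> is the set of words in basis letters and
  \<open>V\<close> the ideal of \<open>T\<close>.\<close>

lemma nf_induct:
  assumes "\<And>w. w \<in> Poly_Mapping.keys f \<Longrightarrow> w \<in> A"
    and "\<And>w h. w \<in> A \<Longrightarrow> rewrites_to \<Sigma> w h \<Longrightarrow> Poly_Mapping.keys h \<subseteq> A"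
    and subspace: "free_alg.subspace V"
    and "\<And>w h. w \<in> A \<Longrightarrow> rewrites_to \<Sigma> w h \<Longrightarrow> word w - h \<in> V"
  shows "Poly_Mapping.keys (nf f) \<subseteq> A \<and> f - nf f \<in> V"
proof -
  have lin: "Poly_Mapping.keys (nf g) \<subseteq> A \<and> g - nf g \<in> V"
    if "Poly_Mapping.keys g \<subseteq> {w. Poly_Mapping.keys (nf_word w) \<subseteq> A \<and> word w - nf_word w \<in> V}" for g
  proof
    show "Poly_Mapping.keys (nf g) \<subseteq> A" using that by (intro keys_lin) blast
    show "g - nf g \<in> V" using that
    proof (induction g rule: free_alg_keys_induct)
      case (add f g)
      then show ?case
        using free_alg.subspace_add[OF subspace, of "f - nf f" "g - nf g"] by (simp add: algebra_simps)
    next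
      case (scale a f)
      then show ?case
        using free_alg.subspace_scale[OF subspace, of "f - nf f" a]
        by (simp add: free_alg.scale_right_diff_distrib)
    qed (auto simp: free_alg.subspace_0[OF subspace])
  qed
  have "w \<in> A \<Longrightarrow> Poly_Mapping.keys (nf_word w) \<subseteq> A \<and> word w - nf_word w \<in> V" for w
  proof (induction w rule: length_induct)
    case (1 w)
    show ?case
    proof (cases "irreducible \<Sigma> w")
      case True
      then show ?thesis using 1 by (simp add: nf_word_irreducible free_alg.subspace_0[OF subspace])
    next
      case False
      note r = rewrites_rewrite[OF False]
      have "Poly_Mapping.keys (nf (rewrite w)) \<subseteq> A \<and> rewrite w - nf (rewrite w) \<in> V"
        using 1 assms(2)[OF _ r] rewrites_shorter[OF r] by (intro lin) blast
      then show ?thesis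
        using free_alg.subspace_add[OF subspace assms(4)[OF 1(2) r], of "rewrite w - nf (rewrite w)"]
        by (simp add: nf_word_reducible False)
    qed
  qed
  then show ?thesis using assms(1) by (intro lin) blast
qed

end

text \<open>With empty \<open>a\<close> and \<open>b\<close>, \<open>no_inclusion\<close> also says
  that a left-hand side determines its right-hand side. In \<open>overlap\<close> the two results
  need only agree modulo relators located in words strictly shorter than the ambiguous one.\<close>

locale confluent = length_reducing +
  assumes no_inclusion: "(W, h) \<in> \<Sigma> \<Longrightarrow> (a @ W @ b, h') \<in> \<Sigma> \<Longrightarrow> a = [] \<and> b = [] \<and> h = h'"
    and overlap: "(a @ b, h) \<in> \<Sigma> \<Longrightarrow> (b @ c, h') \<in> \<Sigma> \<Longrightarrow> a \<noteq> [] \<Longrightarrow> b \<noteq> [] \<Longrightarrow> c \<noteq> [] \<Longrightarrow>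
      h * word c - word a * h' \<in> rel_below \<Sigma> (length (a @ b @ c))"
begin

lemma local_confluence_ordered:
  assumes 1: "(W1, h1) \<in> \<Sigma>" and 2: "(W2, h2) \<in> \<Sigma>" and eq: "W1 @ v1 = t @ W2 @ v2"
  shows "h1 * word v1 - word t * h2 * word v2 \<in> rel_below \<Sigma> (length (W1 @ v1))"
proof -
  \<comment> \<open>Both results reduce further to \<open>h1 * word s * h2 * word v2\<close>. The
    relators used on the way sit in shorter words, since a left-hand side has already given way to
    \<open>h1\<close> or \<open>h2\<close>.\<close>
  have disjoint: ?thesis if t: "t = W1 @ s" and v1: "v1 = s @ W2 @ v2" for s
  proof -
    have "h1 * word s * (word W2 - h2) * word v2 \<in> rel_below \<Sigma> (length (W1 @ v1))"
      using shorter[OF 1] by (intro rel_below_relator_left[OF 2]) (fastforce simp: v1 elim!: keys_mult_subset)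
    moreover have "word [] * (word W1 - h1) * (word s * h2 * word v2) \<in> rel_below \<Sigma> (length (W1 @ v1))"
      using shorter[OF 2] by (intro rel_below_relator_right[OF 1]) (fastforce simp: v1 elim!: keys_mult_subset)
    ultimately have "h1 * word s * (word W2 - h2) * word v2 - word [] * (word W1 - h1) * (word s * h2 * word v2)
        \<in> rel_below \<Sigma> (length (W1 @ v1))"
      by (rule free_alg.span_diff)
    then show ?thesis
      by (simp add: t v1 word_append word_Nil algebra_simps)
  qed
  consider s where "t = W1 @ s" "v1 = s @ W2 @ v2" | s where "W1 = t @ s" "s @ v1 = W2 @ v2" "s \<noteq> []"
    using eq by (fastforce simp: append_eq_append_conv2)
  then show ?thesis
  proof cases
    case 1
    then show ?thesis by (rule disjoint)
  next
    case s: 2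
    consider r where "W2 = s @ r" "v1 = r @ v2" | r where "s = W2 @ r" "v2 = r @ v1"
      using s by (fastforce simp: append_eq_append_conv2)
    then show ?thesis
    proof cases
      case r: 1
      show ?thesis
      proof (cases "t = [] \<or> r = []")
        \<comment> \<open>If one of the outer pieces is empty, one left-hand side contains the
          other, so the two reductions coincide.\<close>
        case True
        then have "t = [] \<and> r = [] \<and> h1 = h2"
          using no_inclusion[of W1 h1 "[]" r h2] no_inclusion[of W2 h2 t "[]" h1] 1 2 s r by auto
        then show ?thesis using r by (simp add: word_Nil free_alg.span_zero)
      next
        case False
        then have "h1 * word r - word t * h2 \<in> rel_below \<Sigma> (length (t @ s @ r))"
          using 1 2 s r by (intro overlap) auto
        from rel_below_context[OF this, of "[]" v2] show ?thesis
          using s r by (simp add: word_Nil word_append algebra_simps)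
      qed
    next
      case r: 2
      then have "t = [] \<and> r = [] \<and> h2 = h1"
        using no_inclusion[of W2 h2 t r h1] 1 2 s by auto
      then show ?thesis using r by (simp add: word_Nil free_alg.span_zero)
    qed
  qed
qed

lemma local_confluence:
  assumes "rewrites_to \<Sigma> w f" "rewrites_to \<Sigma> w g"
  shows "f - g \<in> rel_below \<Sigma> (length w)"
proof -
  obtain u1 W1 h1 v1 where 1: "(W1, h1) \<in> \<Sigma>" "w = u1 @ W1 @ v1" "f = word u1 * h1 * word v1"
    using assms(1) by (auto simp: rewrites_to_def)
  obtain u2 W2 h2 v2 where 2: "(W2, h2) \<in> \<Sigma>" "w = u2 @ W2 @ v2" "g = word u2 * h2 * word v2"
    using assms(2) by (auto simp: rewrites_to_def)
  consider t where "u2 = u1 @ t" "W1 @ v1 = t @ W2 @ v2" | t where "u1 = u2 @ t" "W2 @ v2 = t @ W1 @ v1"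
    using trans[OF 1(2)[symmetric] 2(2)] unfolding append_eq_append_conv2[of u1] by metis
  then show ?thesis
  proof cases
    case t: 1
    from rel_below_context[OF local_confluence_ordered[OF 1(1) 2(1) t(2)], of u1 "[]"]
    show ?thesis by (simp add: 1 2 t(1) word_append word_Nil algebra_simps)
  next
    case t: 2
    from rel_below_context[OF local_confluence_ordered[OF 2(1) 1(1) t(2)], of u2 "[]"]
    have "g - f \<in> rel_below \<Sigma> (length w)"
      by (simp add: 1(3) 2 t(1) word_append word_Nil algebra_simps)
    from free_alg.span_neg[OF this] show ?thesis by simp
  qed
qed

text \<open>The diamond lemma. By induction on length, \<open>nf\<close> kills all relators in
  shorter words, and local confluence puts the difference between the given rewrite and the chosen
  one among their combinations.\<close>

lemma nf_rewrites: "rewrites_to \<Sigma> w f \<Longrightarrow> nf_word w = nf f"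
proof (induction "length w" arbitrary: w f rule: less_induct)
  case less
  have below: "nf x = 0" if "x \<in> rel_below \<Sigma> (length w)" for x
    using that
  proof (induction rule: free_alg.span_induct_alt)
    case (step c x y)
    then obtain u W h v where x: "(W, h) \<in> \<Sigma>" "length (u @ W @ v) < length w" "x = word u * (word W - h) * word v"
      by (auto simp: relators_def)
    have "rewrites_to \<Sigma> (u @ W @ v) (word u * h * word v)"
      using x(1) by (auto simp: rewrites_to_def)
    from less.hyps[OF x(2) this] have "nf x = 0"
      by (simp add: x(3) right_diff_distrib left_diff_distrib flip: word_append)
    then show ?case using step by simp
  qed simp
  have red: "\<not> irreducible \<Sigma> w"
    using less.prems not_irreducible_iff by blast
  have "nf (rewrite w - f) = 0"
    by (intro below local_confluence rewrites_rewrite[OF red] less.prems)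
  then show ?case
    by (simp add: nf_word_reducible[OF red])
qed

text \<open>Bilinear extension of the diamond lemma: \<open>nf\<close> vanishes on the two-sided
  ideal generated by the reductions.\<close>

lemma nf_relator:
  assumes "(W, h) \<in> \<Sigma>"
  shows "nf (f * word W * g) = nf (f * h * g)"
proof -
  have "nf (word u * word W * word v) = nf (word u * h * word v)" for u v
    using nf_rewrites[of "u @ W @ v" "word u * h * word v"] assms
    by (auto simp: rewrites_to_def simp flip: word_append)
  then have "nf (word u * word W * g) = nf (word u * h * g)" for u
    by (induction g rule: free_alg_induct) (auto simp: distrib_left fscale_mult_right)
  then show ?thesis
    by (induction f rule: free_alg_induct) (auto simp: distrib_right fscale_mult_left)
qed

end

section \<open>Relative bases\<close>

definition lincomb :: "('k::field \<Rightarrow> 'v::ab_group_add \<Rightarrow> 'v) \<Rightarrow> ('v \<Rightarrow>\<^sub>0 'k) \<Rightarrow> 'v" where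
  "lincomb scale c = (\<Sum>b\<in>Poly_Mapping.keys c. scale (Poly_Mapping.lookup c b) b)"

context vector_space
begin

lemma lincomb_superset:
  fixes c :: "'b \<Rightarrow>\<^sub>0 'a"
  assumes "finite A" "Poly_Mapping.keys c \<subseteq> A"
  shows "lincomb scale c = (\<Sum>b\<in>A. scale (Poly_Mapping.lookup c b) b)"
  unfolding lincomb_def using assms by (intro sum.mono_neutral_left) (auto simp: in_keys_iff)

lemma lincomb_add: "lincomb scale (c + d) = lincomb scale c + lincomb scale d"
proof -
  let ?A = "Poly_Mapping.keys c \<union> Poly_Mapping.keys d"
  have "Poly_Mapping.keys (c + d) \<subseteq> ?A"
    by (rule keys_add)
  then show ?thesis
    by (simp add: lincomb_superset[of ?A] lookup_add scale_left_distrib sum.distrib)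
qed

lemma lincomb_zero [simp]: "lincomb scale 0 = 0"
  by (simp add: lincomb_def)

lemma lincomb_diff: "lincomb scale (c - d) = lincomb scale c - lincomb scale d"
  using lincomb_add[of "c - d" d] by (simp add: algebra_simps)

lemma lincomb_single: "lincomb scale (Poly_Mapping.single b a) = scale a b"
  by (simp add: lincomb_superset[of "{b}"])

lemma lincomb_in_subspace: "subspace V \<Longrightarrow> Poly_Mapping.keys c \<subseteq> V \<Longrightarrow> lincomb scale c \<in> V"
  unfolding lincomb_def by (intro subspace_sum subspace_scale) auto

lemma lincomb_in_span: "Poly_Mapping.keys c \<subseteq> B \<Longrightarrow> lincomb scale c \<in> span B"
  by (rule lincomb_in_subspace) (auto intro: span_base)

text \<open>Replaces unique decomposition by independence modulo \<open>U\<close>: subtracting two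
  decompositions of one vector leaves a combination of \<open>B\<close> inside
  \<open>U\<close>.\<close>

lemma relative_basis_iff:
  assumes "subspace U" "subspace V"
  shows "relative_basis scale U V B \<longleftrightarrow>
    B \<subseteq> V \<and> (\<forall>v\<in>V. \<exists>u\<in>U. \<exists>c. Poly_Mapping.keys c \<subseteq> B \<and> v = u + lincomb scale c) \<and>
    (\<forall>c. Poly_Mapping.keys c \<subseteq> B \<longrightarrow> lincomb scale c \<in> U \<longrightarrow> c = 0)" (is "_ \<longleftrightarrow> ?R")
proof
  assume *: "relative_basis scale U V B"
  define P where "P v = (\<lambda>(u, c). u \<in> U \<and> Poly_Mapping.keys c \<subseteq> B \<and> v = u + lincomb scale c)" for v
  from * have sub: "B \<subseteq> V" and ex: "\<And>v. v \<in> V \<Longrightarrow> \<exists>!x. P v x"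
    by (auto simp: relative_basis_def lincomb_def P_def)
  have uniq: "x = y" if "v \<in> V" "P v x" "P v y" for v x y
    using ex that by blast
  have "c = 0" if "Poly_Mapping.keys c \<subseteq> B" "lincomb scale c \<in> U" for c
  proof -
    have "lincomb scale c \<in> V"
      using that(1) sub by (intro lincomb_in_subspace assms) auto
    then have "(0, c) = (lincomb scale c, 0)"
      by (rule uniq) (use that subspace_0[OF assms(1)] in \<open>auto simp: P_def\<close>)
    then show ?thesis by simp
  qed
  moreover have "\<exists>u\<in>U. \<exists>c. Poly_Mapping.keys c \<subseteq> B \<and> v = u + lincomb scale c" if "v \<in> V" for v
    using ex1_implies_ex[OF ex[OF that]] by (auto simp: P_def)
  ultimately show ?R using sub by blast
next
  assume R: ?R
  show "relative_basis scale U V B"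
    unfolding relative_basis_def lincomb_def[symmetric]
  proof (intro conjI ballI)
    fix v assume "v \<in> V"
    then obtain u c where uc: "u \<in> U" "Poly_Mapping.keys c \<subseteq> B" "v = u + lincomb scale c"
      using R by blast
    have unique: "u' = u \<and> c' = c"
      if "u' \<in> U" "Poly_Mapping.keys c' \<subseteq> B" "v = u' + lincomb scale c'" for u' c'
    proof -
      have "lincomb scale (c' - c) = u - u'"
        using uc that by (simp add: lincomb_diff algebra_simps)
      moreover have "u - u' \<in> U"
        using uc that by (intro subspace_diff assms)
      moreover have "Poly_Mapping.keys (c' - c) \<subseteq> B"
        using uc that by (intro keys_diff_subset)
      ultimately have "c' - c = 0" using R by metis
      then show ?thesis using uc that by simp
    qed
    show "\<exists>!(u, c). u \<in> U \<and> Poly_Mapping.keys c \<subseteq> B \<and> v = u + lincomb scale c"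
    proof (rule ex1I[of _ "(u, c)"])
      show "x = (u, c)"
        if "case x of (u, c) \<Rightarrow> u \<in> U \<and> Poly_Mapping.keys c \<subseteq> B \<and> v = u + lincomb scale c" for x
        using that unique[of "fst x" "snd x"] by (simp add: split_def prod_eq_iff)
    qed (use uc in simp)
  qed (use R in blast)
qed

lemma relative_basis_trans:
  assumes "subspace U" "subspace V" "subspace W" "U \<subseteq> V" "V \<subseteq> W"
    and "relative_basis scale U V B" "relative_basis scale V W C"
  shows "relative_basis scale U W (B \<union> C)"
proof -
  have B: "B \<subseteq> V" "\<And>v. v \<in> V \<Longrightarrow> \<exists>u\<in>U. \<exists>c. Poly_Mapping.keys c \<subseteq> B \<and> v = u + lincomb scale c"
    "\<And>c. Poly_Mapping.keys c \<subseteq> B \<Longrightarrow> lincomb scale c \<in> U \<Longrightarrow> c = 0"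
    using assms(6) relative_basis_iff[OF assms(1,2)] by auto
  have C: "C \<subseteq> W" "\<And>v. v \<in> W \<Longrightarrow> \<exists>u\<in>V. \<exists>c. Poly_Mapping.keys c \<subseteq> C \<and> v = u + lincomb scale c"
    "\<And>c. Poly_Mapping.keys c \<subseteq> C \<Longrightarrow> lincomb scale c \<in> V \<Longrightarrow> c = 0"
    using assms(7) relative_basis_iff[OF assms(2,3)] by auto
  show ?thesis
    unfolding relative_basis_iff[OF assms(1,3)]
  proof (intro conjI ballI allI impI)
    show "B \<union> C \<subseteq> W" using B(1) C(1) assms(5) by blast
  next
    fix w assume "w \<in> W"
    then obtain v c where c: "v \<in> V" "Poly_Mapping.keys c \<subseteq> C" "w = v + lincomb scale c"
      using C(2) by blast
    then obtain u b where b: "u \<in> U" "Poly_Mapping.keys b \<subseteq> B" "v = u + lincomb scale b"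
      using B(2) by blast
    have "Poly_Mapping.keys (b + c) \<subseteq> B \<union> C" "w = u + lincomb scale (b + c)"
      using b c keys_add[of b c] by (auto simp: lincomb_add add.assoc)
    then show "\<exists>u\<in>U. \<exists>c. Poly_Mapping.keys c \<subseteq> B \<union> C \<and> w = u + lincomb scale c"
      using b(1) by blast
  next
    fix c assume c: "Poly_Mapping.keys c \<subseteq> B \<union> C" "lincomb scale c \<in> U"
    \<comment> \<open>\<open>d\<close> is the part of \<open>c\<close> supported on
      \<open>C\<close>, including any overlap with \<open>B\<close>. The rest lies in
      \<open>V\<close>, so \<open>d\<close> does too and vanishes by independence of
      \<open>C\<close> modulo \<open>V\<close>.\<close>
    define d where "d = (\<Sum>b\<in>Poly_Mapping.keys c \<inter> C. Poly_Mapping.single b (Poly_Mapping.lookup c b))"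
    have lookup_d: "Poly_Mapping.lookup d b = (if b \<in> C then Poly_Mapping.lookup c b else 0)" for b
    proof -
      have "Poly_Mapping.lookup d b = (\<Sum>b'\<in>Poly_Mapping.keys c \<inter> C. if b = b' then Poly_Mapping.lookup c b' else 0)"
        unfolding d_def lookup_sum by (intro sum.cong) (auto simp: lookup_single)
      then show ?thesis by (simp add: in_keys_iff)
    qed
    have d: "Poly_Mapping.keys d \<subseteq> C" "Poly_Mapping.keys (c - d) \<subseteq> B"
      using c(1) by (auto simp: in_keys_iff lookup_d lookup_minus split: if_splits)
    have "lincomb scale (c - d) \<in> V"
      using d B(1) by (intro lincomb_in_subspace assms) auto
    moreover have "lincomb scale c \<in> V" using c assms by blast
    ultimately have "lincomb scale c - lincomb scale (c - d) \<in> V"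
      by (intro subspace_diff assms)
    then have "lincomb scale d \<in> V" by (simp add: lincomb_diff)
    then have "d = 0" using d C(3) by blast
    then show "c = 0" using d c B(3)[of c] by simp
  qed
qed

lemma subspace_set_plus:
  assumes "subspace A" "subspace C"
  shows "subspace (A + C)"
proof -
  have "A + C = {x + y |x y. x \<in> A \<and> y \<in> C}"
    by (auto simp: set_plus_def)
  then show ?thesis using subspace_sums[OF assms] by simp
qed

text \<open>The second isomorphism theorem: A / (A \<inter> C) is isomorphic to (C + A) / C.\<close>

lemma relative_basis_add:
  assumes "subspace A" "subspace C" "relative_basis scale (A \<inter> C) A B"
  shows "relative_basis scale C (C + A) B"
proof -
  have B: "B \<subseteq> A" "\<And>v. v \<in> A \<Longrightarrow> \<exists>u\<in>A \<inter> C. \<exists>c. Poly_Mapping.keys c \<subseteq> B \<and> v = u + lincomb scale c"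
    "\<And>c. Poly_Mapping.keys c \<subseteq> B \<Longrightarrow> lincomb scale c \<in> A \<inter> C \<Longrightarrow> c = 0"
    using assms(3) unfolding relative_basis_iff[OF subspace_inter[OF assms(1,2)] assms(1)] by auto
  show ?thesis
    unfolding relative_basis_iff[OF assms(2) subspace_set_plus[OF assms(2,1)]]
  proof (intro conjI ballI allI impI)
    show "B \<subseteq> C + A"
      using B(1) set_zero_plus2[OF subspace_0[OF assms(2)]] by blast
  next
    fix v assume "v \<in> C + A"
    then obtain x y where xy: "x \<in> C" "y \<in> A" "v = x + y" by (auto elim: set_plus_elim)
    then obtain u c where "u \<in> A \<inter> C" "Poly_Mapping.keys c \<subseteq> B" "y = u + lincomb scale c"
      using B(2) by blast
    then show "\<exists>u\<in>C. \<exists>c. Poly_Mapping.keys c \<subseteq> B \<and> v = u + lincomb scale c"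
      using xy subspace_add[OF assms(2)] by (intro bexI[of _ "x + u"] exI[of _ c]) (auto simp: add.assoc)
  next
    fix c assume c: "Poly_Mapping.keys c \<subseteq> B" "lincomb scale c \<in> C"
    have "lincomb scale c \<in> A" using c B(1) by (intro lincomb_in_subspace assms) auto
    then show "c = 0" using c B(3) by blast
  qed
qed

text \<open>Links relative bases to the notion of independence underlying
  \<open>representation\<close>, and hence \<open>expand\<close>.\<close>

lemma relative_basis_independent:
  assumes "relative_basis scale {0} V B" "subspace V"
  shows "independent B" "span B = V"
proof -
  have B: "B \<subseteq> V" "\<And>v. v \<in> V \<Longrightarrow> \<exists>c. Poly_Mapping.keys c \<subseteq> B \<and> v = lincomb scale c"
    "\<And>c. Poly_Mapping.keys c \<subseteq> B \<Longrightarrow> lincomb scale c = 0 \<Longrightarrow> c = 0"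
    using assms(1) unfolding relative_basis_iff[OF subspace_single_0 assms(2)] by auto
  show "independent B"
  proof
    assume "dependent B"
    then obtain t u where t: "finite t" "t \<subseteq> B" "\<exists>v\<in>t. u v \<noteq> 0" "(\<Sum>v\<in>t. scale (u v) v) = 0"
      unfolding dependent_explicit by blast
    define c where "c = Abs_poly_mapping (\<lambda>v. if v \<in> t then u v else 0)"
    have c: "Poly_Mapping.lookup c = (\<lambda>v. if v \<in> t then u v else 0)"
      unfolding c_def by (rule lookup_Abs_poly_mapping) (use t(1) in simp)
    have "lincomb scale c = (\<Sum>v\<in>t. scale (u v) v)"
      using t(1) by (subst lincomb_superset[of t]) (auto simp: in_keys_iff c split: if_splits)
    then have "c = 0"
      using t by (intro B) (auto simp: in_keys_iff c split: if_splits)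
    then show False using t(3) c by (metis lookup_zero)
  qed
  show "span B = V"
    using B(1,2) lincomb_in_span span_minimal[OF _ assms(2)] by blast
qed

end

section \<open>The reductions of one factor\<close>

lemma append_eq_two: "a @ b = [x, y] \<Longrightarrow> a \<noteq> [] \<Longrightarrow> b \<noteq> [] \<Longrightarrow> a = [x] \<and> b = [y]"
  by (auto simp: append_eq_Cons_conv)

lemma append_eq_three:
  "a @ b = [x, y, z] \<Longrightarrow> a \<noteq> [] \<Longrightarrow> b \<noteq> [] \<Longrightarrow> a = [x] \<and> b = [y, z] \<or> a = [x, y] \<and> b = [z]"
  by (auto simp: append_eq_Cons_conv)

text \<open>One factor seen in isolation: of the other factor only the distinguished letter
  \<open>q'\<close> is visible, and it cannot be confused with a letter of this factor.\<close>

locale inner_inverse_half = k_algebra scale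
  for scale :: "'k::field \<Rightarrow> 'r::ring_1 \<Rightarrow> 'r" +
  fixes p :: 'r and Bpp Bpm Bmp Bmm :: "'r set" and \<iota> :: "'r \<Rightarrow> 'g" and q' :: 'g
  assumes one_notin: "1 \<notin> right_multiples p + left_multiples p"
    and adapted: "adapted_basis scale p Bpp Bpm Bmp Bmm"
    and inj: "inj \<iota>"
    and q': "q' \<notin> range \<iota>"
begin

abbreviation B :: "'r set" where
  "B \<equiv> Bpp \<union> Bpm \<union> Bmp \<union> Bmm"

abbreviation ex :: "'r \<Rightarrow> ('g, 'k) free_alg" where
  "ex \<equiv> expand scale \<iota> B"

abbreviation \<Sigma> :: "('g list \<times> ('g, 'k) free_alg) set" where
  "\<Sigma> \<equiv> reductions scale \<iota> p q' Bpp Bpm Bmp Bmm"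

lemma subspace_right_multiples: "subspace (right_multiples p)"
  unfolding right_multiples_def
  by (rule subspaceI) (auto simp flip: distrib_left scale_mult_right intro: range_eqI[of _ _ 0])

lemma subspace_left_multiples: "subspace (left_multiples p)"
  unfolding left_multiples_def
  by (rule subspaceI) (auto simp flip: distrib_right scale_mult_left intro: range_eqI[of _ _ 0])

lemma subspace_scalars: "subspace (scalars scale)"
  unfolding scalars_def
  by (rule subspaceI) (auto simp flip: scale_left_distrib intro: range_eqI[of _ _ 0])

lemma basis_inter: "relative_basis scale {0} (right_multiples p \<inter> left_multiples p) Bpp"
  and p_in: "p \<in> Bpp"
  and basis_right: "relative_basis scale (right_multiples p \<inter> left_multiples p) (right_multiples p) Bpm"
  and basis_left: "relative_basis scale (right_multiples p \<inter> left_multiples p) (left_multiples p) Bmp"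
  and basis_rest: "relative_basis scale (right_multiples p + left_multiples p + scalars scale) UNIV Bmm"
  using adapted by (auto simp: adapted_basis_def)

lemmas subspaces = subspace_right_multiples subspace_left_multiples subspace_scalars
  subspace_inter subspace_set_plus subspace_single_0 subspace_UNIV

lemma basis_right_multiples: "relative_basis scale {0} (right_multiples p) (Bpp \<union> Bpm)"
  by (rule relative_basis_trans[OF _ _ _ _ _ basis_inter basis_right])
     (auto intro!: subspaces subspace_0)

lemma basis_left_multiples: "relative_basis scale {0} (left_multiples p) (Bpp \<union> Bmp)"
  by (rule relative_basis_trans[OF _ _ _ _ _ basis_inter basis_left])
     (auto intro!: subspaces subspace_0)

text \<open>Applied with \<open>W\<close> equal to pR + Rp; this is where the condition on 1 gives
  the empty word its place in the basis.\<close>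

lemma relative_basis_one:
  assumes "subspace W" "1 \<notin> W"
  shows "relative_basis scale W (W + scalars scale) {1}"
  unfolding relative_basis_iff[OF assms(1) subspace_set_plus[OF assms(1) subspace_scalars]]
proof (intro conjI ballI allI impI)
  have "1 \<in> scalars scale" unfolding scalars_def by (rule range_eqI[of _ _ 1]) simp
  then show "{1} \<subseteq> W + scalars scale"
    using set_zero_plus2[OF subspace_0[OF assms(1)]] by blast
next
  fix v assume "v \<in> W + scalars scale"
  then obtain w a where "w \<in> W" "v = w + scale a 1"
    by (auto simp: scalars_def elim: set_plus_elim)
  then show "\<exists>u\<in>W. \<exists>c. Poly_Mapping.keys c \<subseteq> {1} \<and> v = u + lincomb scale c"
    by (intro bexI[of _ w] exI[of _ "Poly_Mapping.single 1 a"]) (auto simp: lincomb_single)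
next
  fix c :: "'r \<Rightarrow>\<^sub>0 'k" assume c: "Poly_Mapping.keys c \<subseteq> {1}" "lincomb scale c \<in> W"
  let ?a = "Poly_Mapping.lookup c 1"
  have a: "scale ?a 1 \<in> W" using c lincomb_superset[of "{1}" c] by simp
  have "?a = 0"
  proof (rule ccontr)
    assume "?a \<noteq> 0"
    then have "1 \<in> W" using subspace_scale[OF assms(1) a, of "inverse ?a"] by simp
    then show False using assms(2) by simp
  qed
  then show "c = 0" using c(1) by (metis in_keys_iff keys_eq_empty subset_singletonD singletonI)
qed

text \<open>Climbs the chain from 0 through pR, pR + Rp and pR + Rp + k to R. The set
  \<open>Bmp\<close>, given relative to pR \<inter> Rp, serves relative to pR by
  \<open>relative_basis_add\<close>.\<close>

lemma basis_insert_one: "relative_basis scale {0} UNIV (insert 1 B)"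
proof -
  let ?R = "right_multiples p" and ?L = "left_multiples p"
  have zero: "0 \<in> ?R" "0 \<in> ?L" "0 \<in> scalars scale" by (auto intro: subspace_0 subspaces)
  have sub: "?R \<subseteq> ?R + ?L" "?R + ?L \<subseteq> ?R + ?L + scalars scale"
    using set_zero_plus2[OF zero(2), of ?R] set_zero_plus2[OF zero(3), of "?R + ?L"]
    by (simp_all add: add.commute)
  have zero': "{0} \<subseteq> ?R" "{0} \<subseteq> ?R + ?L" "{0} \<subseteq> ?R + ?L + scalars scale"
    using zero sub by auto
  have "relative_basis scale ?R (?R + ?L) Bmp"
    using basis_left by (intro relative_basis_add subspaces) (simp add: Int_commute)
  then have "relative_basis scale {0} (?R + ?L) (Bpp \<union> Bpm \<union> Bmp)"
    by (intro relative_basis_trans[OF _ _ _ zero'(1) sub(1) basis_right_multiples] subspaces)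
  then have "relative_basis scale {0} (?R + ?L + scalars scale) (Bpp \<union> Bpm \<union> Bmp \<union> {1})"
    by (intro relative_basis_trans[OF _ _ _ zero'(2) sub(2) _ relative_basis_one[OF _ one_notin]] subspaces)
  then have "relative_basis scale {0} UNIV (Bpp \<union> Bpm \<union> Bmp \<union> {1} \<union> Bmm)"
    by (intro relative_basis_trans[OF _ _ _ zero'(3) subset_UNIV _ basis_rest] subspaces)
  then show ?thesis by (simp add: Un_ac)
qed

lemma independent_insert_one: "independent (insert 1 B)"
  and span_insert_one: "span (insert 1 B) = UNIV"
  using relative_basis_independent[OF basis_insert_one subspace_UNIV] by auto

text \<open>Needed in the overlaps: an element of pR is a combination of letters each of which can
  close an inner left-hand side.\<close>

lemma span_right: "span (Bpp \<union> Bpm) = right_multiples p"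
  by (rule relative_basis_independent[OF basis_right_multiples subspace_right_multiples])

lemma span_left: "span (Bpp \<union> Bmp) = left_multiples p"
  by (rule relative_basis_independent[OF basis_left_multiples subspace_left_multiples])

text \<open>\<open>expand\<close> treats 1 as the empty word, so a letter equal to 1 would be
  lost.\<close>

lemma one_notin_B: "1 \<notin> B"
proof -
  have zero: "0 \<in> right_multiples p" "0 \<in> left_multiples p" by (auto intro: subspace_0 subspaces)
  have sub: "Bpp \<subseteq> right_multiples p" "Bpm \<subseteq> right_multiples p" "Bmp \<subseteq> left_multiples p"
    using adapted by (auto simp: adapted_basis_def relative_basis_def)
  have "1 \<notin> right_multiples p" "1 \<notin> left_multiples p"
    using one_notin set_plus_intro[OF _ zero(2), of 1] set_plus_intro[OF zero(1), of 1] by auto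
  moreover have "1 \<notin> Bmm"
  proof
    let ?U = "right_multiples p + left_multiples p + scalars scale"
    assume 1: "1 \<in> Bmm"
    have "1 \<in> scalars scale" unfolding scalars_def by (rule range_eqI[of _ _ 1]) simp
    then have "1 \<in> ?U"
      using set_plus_intro[OF set_plus_intro[OF zero], of 1] by simp
    then have "Poly_Mapping.single 1 1 = (0 :: 'r \<Rightarrow>\<^sub>0 'k)"
      using basis_rest 1 unfolding relative_basis_iff[OF subspace_set_plus[OF subspace_set_plus[OF subspace_right_multiples subspace_left_multiples] subspace_scalars] subspace_UNIV]
      by (auto simp: lincomb_single)
    then show False by (metis lookup_single_eq lookup_zero zero_neq_one)
  qed
  ultimately show ?thesis using sub by blast
qed

section \<open>Linearity and support of expansions\<close>

lemma ex_superset: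
  assumes "finite A" "{b. representation (insert 1 B) r b \<noteq> 0} \<subseteq> A"
  shows "ex r = (\<Sum>b\<in>A. Poly_Mapping.single (if b = 1 then [] else [\<iota> b]) (representation (insert 1 B) r b))"
  unfolding expand_def Let_def using assms by (intro sum.mono_neutral_left) auto

lemma ex_add: "ex (x + y) = ex x + ex y"
proof -
  let ?r = "representation (insert 1 B)"
  let ?A = "{b. ?r x b \<noteq> 0} \<union> {b. ?r y b \<noteq> 0}"
  have r: "?r (x + y) = (\<lambda>b. ?r x b + ?r y b)"
    by (rule representation_add[OF independent_insert_one]) (simp_all add: span_insert_one)
  have "{b. ?r (x + y) b \<noteq> 0} \<subseteq> ?A" unfolding r by auto
  then show ?thesis
    using finite_representation[of "insert 1 B"]
    by (simp add: ex_superset[of ?A] r single_add sum.distrib)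
qed

lemma ex_scale: "ex (scale a x) = fscale a (ex x)"
proof -
  let ?r = "representation (insert 1 B)"
  let ?A = "{b. ?r x b \<noteq> 0}"
  have r: "?r (scale a x) = (\<lambda>b. a * ?r x b)"
    by (rule representation_scale[OF independent_insert_one]) (simp add: span_insert_one)
  have "{b. ?r (scale a x) b \<noteq> 0} \<subseteq> ?A" unfolding r by auto
  then show ?thesis
    using finite_representation[of "insert 1 B"]
    by (simp add: ex_superset[of ?A] r free_alg.scale_sum_right flip: fscale_word)
qed

lemma ex_zero: "ex 0 = 0"
  using ex_scale[of 0 0] by simp

lemma ex_basis:
  assumes "b \<in> insert 1 B"
  shows "ex b = word (if b = 1 then [] else [\<iota> b])"
proof -
  have "representation (insert 1 B) b = (\<lambda>v. if v = b then 1 else 0)"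
    by (rule representation_basis[OF independent_insert_one assms])
  then show ?thesis
    by (subst ex_superset[of "{b}"]) (auto simp: word_def)
qed

lemma ex_one [simp]: "ex 1 = 1"
  by (simp add: ex_basis word_Nil)

lemma ex_letter: "b \<in> B \<Longrightarrow> ex b = word [\<iota> b]"
  using ex_basis[of b] one_notin_B by auto

lemma keys_ex: "Poly_Mapping.keys (ex r) \<subseteq> insert [] ((\<lambda>b. [\<iota> b]) ` B)"
proof -
  have "ex r \<in> {f. Poly_Mapping.keys f \<subseteq> insert [] ((\<lambda>b. [\<iota> b]) ` B)}"
    unfolding expand_def Let_def
    by (intro free_alg.subspace_sum[OF subspace_keys])
       (auto split: if_splits dest!: representation_ne_zero)
  then show ?thesis by simp
qed

section \<open>Left-hand sides of one factor and their overlaps\<close>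

lemma \<Sigma>_cases:
  assumes "(W, h) \<in> \<Sigma>"
  obtains (prod) x y where "x \<in> B" "y \<in> B" "W = [\<iota> x, \<iota> y]" "h = ex (x * y)"
  | (inner) x y where "x * p \<in> Bpp \<union> Bmp" "p * y \<in> Bpp \<union> Bpm" "W = [\<iota> (x * p), q', \<iota> (p * y)]"
      "h = ex (x * p * y)"
  using assms unfolding reductions_def Let_def by blast

lemma \<Sigma>_prod: "x \<in> B \<Longrightarrow> y \<in> B \<Longrightarrow> ([\<iota> x, \<iota> y], ex (x * y)) \<in> \<Sigma>"
  unfolding reductions_def Let_def by blast

lemma \<Sigma>_inner:
  "x * p \<in> Bpp \<union> Bmp \<Longrightarrow> p * y \<in> Bpp \<union> Bpm \<Longrightarrow> ([\<iota> (x * p), q', \<iota> (p * y)], ex (x * p * y)) \<in> \<Sigma>"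
  unfolding reductions_def Let_def by blast

text \<open>Forbidden words are indexed by letters, inner reductions by cofactors x and y. The two
  match because the letters concerned are multiples of p.\<close>

lemma fst_\<Sigma>: "fst ` \<Sigma> = forbidden \<iota> q' Bpp Bpm Bmp Bmm"
proof -
  have l: "\<exists>x. u = x * p" if "u \<in> Bpp \<union> Bmp" for u
    using that span_left span_base[of u "Bpp \<union> Bmp"] by (auto simp: left_multiples_def)
  have r: "\<exists>y. v = p * y" if "v \<in> Bpp \<union> Bpm" for v
    using that span_right span_base[of v "Bpp \<union> Bpm"] by (auto simp: right_multiples_def)
  show ?thesis
  proof
    show "fst ` \<Sigma> \<subseteq> forbidden \<iota> q' Bpp Bpm Bmp Bmm"
      by (fastforce simp: forbidden_def Let_def elim!: \<Sigma>_cases)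
    show "forbidden \<iota> q' Bpp Bpm Bmp Bmm \<subseteq> fst ` \<Sigma>"
    proof
      fix W assume "W \<in> forbidden \<iota> q' Bpp Bpm Bmp Bmm"
      then consider x y where "W = [\<iota> x, \<iota> y]" "x \<in> B" "y \<in> B"
        | u v where "W = [\<iota> u, q', \<iota> v]" "u \<in> Bpp \<union> Bmp" "v \<in> Bpp \<union> Bpm"
        unfolding forbidden_def Let_def by blast
      then show "W \<in> fst ` \<Sigma>"
      proof cases
        case 1
        then show ?thesis using \<Sigma>_prod by force
      next
        case 2
        then show ?thesis using l[of u] r[of v] \<Sigma>_inner by force
      qed
    qed
  qed
qed

lemma \<Sigma>_shorter: "(W, h) \<in> \<Sigma> \<Longrightarrow> w \<in> Poly_Mapping.keys h \<Longrightarrow> length w < length W"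
  using keys_ex by (fastforce elim!: \<Sigma>_cases)

lemma \<Sigma>_no_inclusion:
  assumes "(W, h) \<in> \<Sigma>" "(a @ W @ b, h') \<in> \<Sigma>"
  shows "a = [] \<and> b = [] \<and> h = h'"
proof -
  \<comment> \<open>The cofactors of a letter need not be unique, but xpy depends only on xp and py.
    This makes the right-hand side of an inner reduction well defined.\<close>
  have *: "x * p * y = x' * p * y'" if "x * p = x' * p" "p * y = p * y'" for x y x' y'
    using that by (metis mult.assoc)
  show ?thesis
    using assms(1)
  proof (cases rule: \<Sigma>_cases)
    case (prod x y)
    from assms(2) show ?thesis
    proof (cases rule: \<Sigma>_cases)
      case (prod x' y')
      have "a @ [\<iota> x, \<iota> y] @ b = [\<iota> x', \<iota> y']"
        using prod(3) \<open>W = _\<close> by simp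
      then have "a = [] \<and> b = [] \<and> x = x' \<and> y = y'"
        by (auto simp: append_eq_Cons_conv inj_eq[OF inj])
      then show ?thesis using prod(4) \<open>h = _\<close> by simp
    next
      case (inner x' y')
      have "a @ [\<iota> x, \<iota> y] @ b = [\<iota> (x' * p), q', \<iota> (p * y')]"
        using inner(3) \<open>W = _\<close> by simp
      then have "q' = \<iota> x \<or> q' = \<iota> y"
        by (auto simp: append_eq_Cons_conv)
      then show ?thesis using q' by auto
    qed
  next
    case (inner x y)
    from assms(2) show ?thesis
    proof (cases rule: \<Sigma>_cases)
      case (prod x' y')
      have "a @ [\<iota> (x * p), q', \<iota> (p * y)] @ b = [\<iota> x', \<iota> y']"
        using prod(3) \<open>W = _\<close> by simp
      from arg_cong[OF this, of length] show ?thesis by simp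
    next
      case (inner x' y')
      have "a @ [\<iota> (x * p), q', \<iota> (p * y)] @ b = [\<iota> (x' * p), q', \<iota> (p * y')]"
        using inner(3) \<open>W = _\<close> by simp
      then have "a = [] \<and> b = [] \<and> x * p = x' * p \<and> p * y = p * y'"
        by (auto simp: append_eq_Cons_conv inj_eq[OF inj])
      then show ?thesis using inner(4) \<open>h = _\<close> *[of x x' y y'] by simp
    qed
  qed
qed

text \<open>Congruences between expansions are linear in each argument, so letters suffice. The
  spanning set is left variable: all of \<open>insert 1 B\<close> for products, only the letters of
  pR or Rp for inner reductions.\<close>

lemma linear_in_subspace:
  assumes V: "free_alg.subspace V" and r: "r \<in> span A"
    and add: "\<And>x y. f (x + y) = f x + f y" and scale: "\<And>a x. f (scale a x) = fscale a (f x)"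
    and base: "\<And>b. b \<in> A \<Longrightarrow> f b \<in> V"
  shows "f r \<in> V"
  using r
proof (induction rule: span_induct_alt)
  case base
  then show ?case using scale[of 0 0] by (simp add: free_alg.subspace_0[OF V])
next
  case (step c x y)
  then show ?case
    by (simp add: add scale base free_alg.subspace_add[OF V] free_alg.subspace_scale[OF V])
qed

lemmas bilinear_simps = ex_add ex_scale distrib_left distrib_right fscale_mult_left fscale_mult_right
  scale_mult_left scale_mult_right free_alg.scale_right_diff_distrib

text \<open>On a basis letter the difference is a relator in a word of length 2, hence the bound 3;
  on 1 it is zero.\<close>

lemma ex_mult_letter:
  assumes "z \<in> B" "3 \<le> n"
  shows "ex r * word [\<iota> z] - ex (r * z) \<in> rel_below \<Sigma> n"
proof (rule linear_in_subspace[where f = "\<lambda>r. ex r * word [\<iota> z] - ex (r * z)" and A = "insert 1 B"])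
  fix b assume b: "b \<in> insert 1 B"
  show "ex b * word [\<iota> z] - ex (b * z) \<in> rel_below \<Sigma> n"
  proof (cases "b = 1")
    case True
    then show ?thesis using assms by (simp add: ex_letter free_alg.span_zero)
  next
    case False
    with b have "b \<in> B" by simp
    then show ?thesis
      using rel_below_relator[OF \<Sigma>_prod, of b z "[]" "[]" n] assms
      by (simp add: ex_letter word_Nil flip: word_append)
  qed
qed (auto simp: span_insert_one bilinear_simps)

lemma letter_mult_ex:
  assumes "z \<in> B" "3 \<le> n"
  shows "word [\<iota> z] * ex r - ex (z * r) \<in> rel_below \<Sigma> n"
proof (rule linear_in_subspace[where f = "\<lambda>r. word [\<iota> z] * ex r - ex (z * r)" and A = "insert 1 B"])
  fix b assume b: "b \<in> insert 1 B"
  show "word [\<iota> z] * ex b - ex (z * b) \<in> rel_below \<Sigma> n"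
  proof (cases "b = 1")
    case True
    then show ?thesis using assms by (simp add: ex_letter free_alg.span_zero)
  next
    case False
    with b have "b \<in> B" by simp
    then show ?thesis
      using rel_below_relator[OF \<Sigma>_prod, of z b "[]" "[]" n] assms
      by (simp add: ex_letter word_Nil flip: word_append)
  qed
qed (auto simp: span_insert_one bilinear_simps)

text \<open>For \<open>r\<close> in pR the claim reduces to letters of the form
  \<open>p * y\<close>, each completing an inner left-hand side. That has length 3, hence the bound
  4.\<close>

lemma inner_mult_ex:
  assumes "x * p \<in> Bpp \<union> Bmp" "4 \<le> n" "r \<in> right_multiples p"
  shows "word [\<iota> (x * p), q'] * ex r - ex (x * r) \<in> rel_below \<Sigma> n"
proof (rule linear_in_subspace[where f = "\<lambda>r. word [\<iota> (x * p), q'] * ex r - ex (x * r)" and A = "Bpp \<union> Bpm"])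
  fix b assume b: "b \<in> Bpp \<union> Bpm"
  then obtain y where y: "b = p * y"
    using span_right span_base[of b "Bpp \<union> Bpm"] by (auto simp: right_multiples_def)
  then show "word [\<iota> (x * p), q'] * ex b - ex (x * b) \<in> rel_below \<Sigma> n"
    using rel_below_relator[OF \<Sigma>_inner, of x y "[]" "[]" n] assms b ex_letter[of b]
    by (auto simp: word_Nil mult.assoc simp flip: word_append)
qed (auto simp: span_right assms bilinear_simps)

lemma ex_mult_inner:
  assumes "p * y \<in> Bpp \<union> Bpm" "4 \<le> n" "r \<in> left_multiples p"
  shows "ex r * word [q', \<iota> (p * y)] - ex (r * y) \<in> rel_below \<Sigma> n"
proof (rule linear_in_subspace[where f = "\<lambda>r. ex r * word [q', \<iota> (p * y)] - ex (r * y)" and A = "Bpp \<union> Bmp"])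
  fix b assume b: "b \<in> Bpp \<union> Bmp"
  then obtain x where x: "b = x * p"
    using span_left span_base[of b "Bpp \<union> Bmp"] by (auto simp: left_multiples_def)
  then show "ex b * word [q', \<iota> (p * y)] - ex (b * y) \<in> rel_below \<Sigma> n"
    using rel_below_relator[OF \<Sigma>_inner, of x y "[]" "[]" n] assms b ex_letter[of b]
    by (auto simp: word_Nil mult.assoc simp flip: word_append)
qed (auto simp: span_left assms bilinear_simps)

lemma rel_below_diff_cancel:
  assumes "f - e \<in> rel_below \<Sigma> n" "g - e \<in> rel_below \<Sigma> n"
  shows "f - g \<in> rel_below \<Sigma> n"
  using free_alg.span_diff[OF assms] by simp

text \<open>The shared part is always a single letter, because \<open>q'\<close> is not a letter of
  this factor. In all four cases both results agree, modulo shorter words, with the expansion of one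
  product in R, which associativity makes the same for both.\<close>

lemma \<Sigma>_overlap:
  assumes "(a @ b, h) \<in> \<Sigma>" "(b @ c, h') \<in> \<Sigma>" and ne: "a \<noteq> []" "b \<noteq> []" "c \<noteq> []"
  shows "h * word c - word a * h' \<in> rel_below \<Sigma> (length (a @ b @ c))"
  using assms(1)
proof (cases rule: \<Sigma>_cases)
  case 1: (prod x y)
  from append_eq_two[OF this(3) ne(1,2)] have ab: "a = [\<iota> x]" "b = [\<iota> y]" by auto
  from assms(2) show ?thesis
  proof (cases rule: \<Sigma>_cases)
    case (prod y' z)
    with ab have c: "y' = y" "c = [\<iota> z]" by (auto simp: inj_eq[OF inj])
    have "ex (x * y) * word [\<iota> z] - word [\<iota> x] * ex (y * z) \<in> rel_below \<Sigma> 3"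
      using ex_mult_letter[OF prod(2), of 3 "x * y"] letter_mult_ex[OF 1(1), of 3 "y * z"]
      by - (rule rel_below_diff_cancel[where e = "ex (x * y * z)"], simp_all add: mult.assoc)
    then show ?thesis
      using 1 prod by (simp add: ab c eval_nat_numeral)
  next
    case (inner z t)
    with ab have c: "y = z * p" "c = [q', \<iota> (p * t)]" by (auto simp: inj_eq[OF inj])
    \<comment> \<open>The shared letter is a left multiple of p, hence so is the product, and the
      inner reduction applies to its whole expansion.\<close>
    have "x * y \<in> left_multiples p"
      using c by (auto simp: left_multiples_def simp flip: mult.assoc)
    then have "ex (x * y) * word [q', \<iota> (p * t)] - word [\<iota> x] * ex (z * p * t) \<in> rel_below \<Sigma> 4"
      using ex_mult_inner[OF inner(2), of 4 "x * y"] letter_mult_ex[OF 1(1), of 4 "z * p * t"] c(1)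
      by - (rule rel_below_diff_cancel[where e = "ex (x * y * t)"], simp_all add: mult.assoc)
    then show ?thesis
      using 1 inner by (simp add: ab c eval_nat_numeral)
  qed
next
  case 1: (inner x y)
  from assms(2) show ?thesis
  proof (cases rule: \<Sigma>_cases)
    case (prod y' z)
    with append_eq_three[OF 1(3) ne(1,2)] q' have c: "a = [\<iota> (x * p), q']" "b = [\<iota> (p * y)]" "y' = p * y" "c = [\<iota> z]"
      by (auto simp: inj_eq[OF inj])
    have "y' * z \<in> right_multiples p"
      using c by (auto simp: right_multiples_def mult.assoc)
    then have "ex (x * p * y) * word [\<iota> z] - word [\<iota> (x * p), q'] * ex (y' * z) \<in> rel_below \<Sigma> 4"
      using ex_mult_letter[OF prod(2), of 4 "x * p * y"] inner_mult_ex[OF 1(1), of 4 "y' * z"] c(3)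
      by - (rule rel_below_diff_cancel[where e = "ex (x * p * y * z)"], simp_all add: mult.assoc)
    then show ?thesis
      using 1 prod by (simp add: c eval_nat_numeral)
  next
    case (inner z t)
    with append_eq_three[OF 1(3) ne(1,2)] q' have c: "a = [\<iota> (x * p), q']" "b = [\<iota> (p * y)]" "p * y = z * p" "c = [q', \<iota> (p * t)]"
      by (auto simp: inj_eq[OF inj])
    \<comment> \<open>The shared letter lies in pR \<inter> Rp, and its two descriptions
      \<open>p * y\<close> and \<open>z * p\<close> are traded for each other: each partial product
      becomes a multiple of p on the side where the remaining inner reduction needs it.\<close>
    have eq: "x * p * y = x * z * p" "z * p * t = p * (y * t)" "x * (p * (y * t)) = x * z * p * t"
      using c(3) by (metis mult.assoc)+
    have "x * p * y \<in> left_multiples p" "z * p * t \<in> right_multiples p"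
      unfolding eq by (auto simp: right_multiples_def left_multiples_def)
    then have "ex (x * p * y) * word [q', \<iota> (p * t)] - word [\<iota> (x * p), q'] * ex (z * p * t) \<in> rel_below \<Sigma> 5"
      using ex_mult_inner[OF inner(2), of 5 "x * p * y"] inner_mult_ex[OF 1(1), of 5 "z * p * t"]
      by - (rule rel_below_diff_cancel[where e = "ex (x * z * p * t)"], simp_all add: eq)
    then show ?thesis
      using 1 inner by (simp add: c eval_nat_numeral)
  qed
qed

end

section \<open>Ideals and quotients of the free algebra\<close>

lemma free_algebra_simps [simp]:
  "carrier free_algebra = UNIV"
  "f \<otimes>\<^bsub>free_algebra\<^esub> g = f * g"
  "f \<oplus>\<^bsub>free_algebra\<^esub> g = f + g"
  "\<one>\<^bsub>free_algebra\<^esub> = 1"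
  "\<zero>\<^bsub>free_algebra\<^esub> = 0"
  "a \<odot>\<^bsub>free_algebra\<^esub> f = fscale a f"
  by (simp_all add: free_algebra_def)

lemma ring_free_algebra: "ring (free_algebra :: ('k::field, ('g, 'k) free_alg) module)"
proof (intro ringI abelian_groupI monoidI)
  fix f :: "('g, 'k) free_alg"
  show "\<exists>g\<in>carrier free_algebra. g \<oplus>\<^bsub>free_algebra\<^esub> f = \<zero>\<^bsub>free_algebra\<^esub>"
    by (intro bexI[of _ "- f"]) auto
qed (simp_all add: algebra_simps)

lemma a_inv_free_algebra: "\<ominus>\<^bsub>free_algebra\<^esub> f = - (f :: ('g, 'k::field) free_alg)"
proof -
  interpret ring "free_algebra :: ('k, ('g, 'k) free_alg) module" by (rule ring_free_algebra)
  show ?thesis by (rule minus_equality) simp_all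
qed

lemma ideal_free_algebraI:
  fixes V :: "('g, 'k::field) free_alg set"
  assumes "free_alg.subspace V" "\<And>f g. g \<in> V \<Longrightarrow> f * g \<in> V" "\<And>f g. g \<in> V \<Longrightarrow> g * f \<in> V"
  shows "ideal V free_algebra"
proof (rule idealI[OF ring_free_algebra])
  have "inv\<^bsub>add_monoid free_algebra\<^esub> f = - f" for f :: "('g, 'k) free_alg"
    using a_inv_free_algebra[of f] by (simp add: a_inv_def)
  then show "subgroup V (add_monoid free_algebra)"
    using assms(1) by (auto intro!: subgroup.intro simp: free_alg.subspace_add free_alg.subspace_0 free_alg.subspace_neg)
qed (use assms in auto)

lemma ideal_mult:
  assumes "ideal V free_algebra" "g \<in> V"
  shows "f * g \<in> V" "g * f \<in> V"
  using ideal.I_l_closed[OF assms, of f] ideal.I_r_closed[OF assms, of f] by simp_all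

lemma ideal_subspace:
  fixes V :: "('g, 'k::field) free_alg set"
  assumes "ideal V free_algebra"
  shows "free_alg.subspace V"
proof (rule free_alg.subspaceI)
  interpret ideal V "free_algebra :: ('k, ('g, 'k) free_alg) module" by fact
  show "0 \<in> V" using additive_subgroup.zero_closed[OF ideal.axioms(1)[OF assms]] by simp
  show "f + g \<in> V" if "f \<in> V" "g \<in> V" for f g using additive_subgroup.a_closed[OF ideal.axioms(1)[OF assms] that] by simp
  show "fscale a f \<in> V" if "f \<in> V" for a f
    unfolding fscale_def by (rule ideal_mult[OF assms that])
qed

lemma ideal_cong_mult:
  assumes "ideal V free_algebra" "f - f' \<in> V" "g - g' \<in> V"
  shows "f * g - f' * g' \<in> V"
proof -
  have "(f - f') * g + f' * (g - g') \<in> V"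
    by (intro free_alg.subspace_add[OF ideal_subspace[OF assms(1)]] ideal_mult[OF assms(1)] assms)
  then show ?thesis by (simp add: algebra_simps)
qed

lemma subspace_cong_trans:
  assumes "free_alg.subspace V" "f - g \<in> V" "g - h \<in> V"
  shows "f - h \<in> V"
  using free_alg.subspace_add[OF assms] by simp

lemma subspace_cong_sym:
  assumes "free_alg.subspace V" "f - g \<in> V"
  shows "g - f \<in> V"
  using free_alg.subspace_neg[OF assms] by simp

lemma coset_eq_iff:
  fixes f g :: "('g, 'k::field) free_alg"
  assumes "ideal I free_algebra"
  shows "I +>\<^bsub>free_algebra\<^esub> f = I +>\<^bsub>free_algebra\<^esub> g \<longleftrightarrow> f - g \<in> I"
proof -
  note sub = ideal_subspace[OF assms]
  have coset: "I +>\<^bsub>free_algebra\<^esub> f = {x. x - f \<in> I}" for f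
    by (force simp: a_r_coset_def' intro: bexI[of _ "_ - f"])
  show ?thesis
    unfolding coset
  proof
    assume "{x. x - f \<in> I} = {x. x - g \<in> I}"
    moreover have "f \<in> {x. x - f \<in> I}" using free_alg.subspace_0[OF sub] by simp
    ultimately show "f - g \<in> I" by blast
  next
    assume "f - g \<in> I"
    then show "{x. x - f \<in> I} = {x. x - g \<in> I}"
      using subspace_cong_trans[OF sub] subspace_cong_sym[OF sub] by blast
  qed
qed

lemma carrier_quotient_algebra:
  "carrier (quotient_algebra free_algebra I) = range (\<lambda>f. I +>\<^bsub>free_algebra\<^esub> f)"
  by (auto simp: quotient_algebra_def ring.defs FactRing_def A_RCOSETS_def')

text \<open>The scalar multiplication is a union over all representatives of the coset; each
  contributes the same coset.\<close>

lemma smult_quotient_algebra: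
  assumes "ideal I free_algebra"
  shows "a \<odot>\<^bsub>quotient_algebra free_algebra I\<^esub> (I +>\<^bsub>free_algebra\<^esub> f) = I +>\<^bsub>free_algebra\<^esub> fscale a f"
proof -
  note sub = ideal_subspace[OF assms]
  have "I +>\<^bsub>free_algebra\<^esub> fscale a x = I +>\<^bsub>free_algebra\<^esub> fscale a f"
    if "x \<in> I +>\<^bsub>free_algebra\<^esub> f" for x
  proof -
    have "x - f \<in> I" using that by (auto simp: a_r_coset_def')
    then have "fscale a (x - f) \<in> I" by (rule free_alg.subspace_scale[OF sub])
    then show ?thesis
      by (simp add: coset_eq_iff[OF assms] free_alg.scale_right_diff_distrib)
  qed
  moreover have "f \<in> I +>\<^bsub>free_algebra\<^esub> f"
    using free_alg.subspace_0[OF sub] by (force simp: a_r_coset_def')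
  ultimately have "(\<Union>x\<in>I +>\<^bsub>free_algebra\<^esub> f. I +>\<^bsub>free_algebra\<^esub> fscale a x) = I +>\<^bsub>free_algebra\<^esub> fscale a f"
    by (intro SUP_eq_const) blast+
  then show ?thesis
    by (simp add: quotient_algebra_def ring.defs module.defs)
qed

lemma add_quotient_algebra:
  fixes I :: "('g, 'k::field) free_alg set"
  assumes "ideal I free_algebra"
  shows "(I +>\<^bsub>free_algebra\<^esub> f) \<oplus>\<^bsub>quotient_algebra free_algebra I\<^esub> (I +>\<^bsub>free_algebra\<^esub> g) =
    I +>\<^bsub>free_algebra\<^esub> (f + g)"
proof -
  interpret ideal I "free_algebra :: ('k, ('g, 'k) free_alg) module" by fact
  show ?thesis
    using ring_hom_add[OF rcos_ring_hom, of f g] by (simp add: quotient_algebra_def ring.defs)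
qed

lemma zero_quotient_algebra:
  fixes I :: "('g, 'k::field) free_alg set"
  assumes "ideal I free_algebra"
  shows "\<zero>\<^bsub>quotient_algebra free_algebra I\<^esub> = I +>\<^bsub>free_algebra\<^esub> 0"
  by (auto simp: quotient_algebra_def ring.defs FactRing_def a_r_coset_def')

lemma abelian_monoid_quotient_algebra:
  assumes "ideal I free_algebra"
  shows "abelian_monoid (quotient_algebra free_algebra I)"
  by (rule abelian_monoidI)
     (auto simp: carrier_quotient_algebra add_quotient_algebra[OF assms] zero_quotient_algebra[OF assms] ac_simps)

lemma finsum_quotient_algebra:
  fixes I :: "('g, 'k::field) free_alg set"
  assumes "ideal I free_algebra" "finite A"
  shows "(\<Oplus>\<^bsub>quotient_algebra free_algebra I\<^esub>e\<in>A. I +>\<^bsub>free_algebra\<^esub> f e) =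
    I +>\<^bsub>free_algebra\<^esub> (\<Sum>e\<in>A. f e)"
proof -
  interpret abelian_monoid "quotient_algebra free_algebra I"
    by (rule abelian_monoid_quotient_algebra[OF assms(1)])
  show ?thesis
    using assms(2)
  proof (induction A rule: finite_induct)
    case empty
    then show ?case by (simp add: zero_quotient_algebra[OF assms(1)])
  next
    case (insert x F)
    then show ?case
      by (subst finsum_insert) (auto simp: carrier_quotient_algebra add_quotient_algebra[OF assms(1)])
  qed
qed

text \<open>\<open>nf\<close> provides spanning and \<open>indep\<close> independence. The work lies
  in passing between coefficients indexed by cosets and elements of the free algebra.\<close>

lemma quotient_basis:
  fixes I :: "('g, 'k::field) free_alg set" and N :: "'g list set"
  assumes I: "ideal I free_algebra"
    and nf: "\<And>f. \<exists>g. Poly_Mapping.keys g \<subseteq> N \<and> f - g \<in> I"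
    and indep: "\<And>f. Poly_Mapping.keys f \<subseteq> N \<Longrightarrow> f \<in> I \<Longrightarrow> f = 0"
  shows "inj_on (\<lambda>w. I +>\<^bsub>free_algebra\<^esub> word w) N"
    and "is_basis (quotient_algebra free_algebra I) ((\<lambda>w. I +>\<^bsub>free_algebra\<^esub> word w) ` N)"
proof -
  define b where "b w = I +>\<^bsub>free_algebra\<^esub> (word w :: ('g, 'k) free_alg)" for w
  have inj: "inj_on b N"
  proof
    fix u v assume uv: "u \<in> N" "v \<in> N" "b u = b v"
    then have "word u - word v \<in> I" by (simp add: b_def coset_eq_iff[OF I])
    then have "word u - word v = (0 :: ('g, 'k) free_alg)"
      using uv by (intro indep keys_diff_subset) auto
    then show "u = v" by (simp add: word_inject)
  qed
  then show "inj_on (\<lambda>w. I +>\<^bsub>free_algebra\<^esub> word w) N" by (simp add: b_def[abs_def])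
  let ?Q = "quotient_algebra free_algebra I"
  \<comment> \<open>Pulls coefficients indexed by cosets back to words. Injectivity of
    \<open>b\<close> on \<open>N\<close> ensures that no two coefficients are merged.\<close>
  define lift where "lift c = (\<Sum>e\<in>Poly_Mapping.keys c.
    fscale (Poly_Mapping.lookup c e) (word (inv_into N b e)))" for c :: "('g, 'k) free_alg set \<Rightarrow>\<^sub>0 'k"
  have keys_lift: "Poly_Mapping.keys (lift c) \<subseteq> N" if "Poly_Mapping.keys c \<subseteq> b ` N" for c
  proof -
    have "lift c \<in> {f. Poly_Mapping.keys f \<subseteq> N}"
      unfolding lift_def using that
      by (intro free_alg.subspace_sum[OF subspace_keys] free_alg.subspace_scale[OF subspace_keys])
         (auto intro: inv_into_into)
    then show ?thesis by simp
  qed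
  have lookup_lift: "Poly_Mapping.lookup (lift c) w = Poly_Mapping.lookup c (b w)"
    if "Poly_Mapping.keys c \<subseteq> b ` N" "w \<in> N" for c w
  proof -
    have "Poly_Mapping.lookup (lift c) w =
        (\<Sum>e\<in>Poly_Mapping.keys c. if e = b w then Poly_Mapping.lookup c e else 0)"
      unfolding lift_def lookup_sum using that inj
      by (intro sum.cong) (auto simp: lookup_word)
    then show ?thesis by (simp add: in_keys_iff)
  qed
  have finsum: "(\<Oplus>\<^bsub>?Q\<^esub>e\<in>Poly_Mapping.keys c. Poly_Mapping.lookup c e \<odot>\<^bsub>?Q\<^esub> e) = I +>\<^bsub>free_algebra\<^esub> lift c"
    if "Poly_Mapping.keys c \<subseteq> b ` N" for c
  proof -
    interpret Q: abelian_monoid ?Q by (rule abelian_monoid_quotient_algebra[OF I])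
    have "Poly_Mapping.lookup c e \<odot>\<^bsub>?Q\<^esub> e =
        I +>\<^bsub>free_algebra\<^esub> fscale (Poly_Mapping.lookup c e) (word (inv_into N b e))"
      if "e \<in> Poly_Mapping.keys c" for e
    proof -
      have "e = I +>\<^bsub>free_algebra\<^esub> word (inv_into N b e)"
        using that \<open>Poly_Mapping.keys c \<subseteq> b ` N\<close> f_inv_into_f[of e b N] by (auto simp: b_def)
      then show ?thesis
        using smult_quotient_algebra[OF I, of "Poly_Mapping.lookup c e" "word (inv_into N b e)"] by simp
    qed
    then have "(\<Oplus>\<^bsub>?Q\<^esub>e\<in>Poly_Mapping.keys c. Poly_Mapping.lookup c e \<odot>\<^bsub>?Q\<^esub> e) = (\<Oplus>\<^bsub>?Q\<^esub>e\<in>Poly_Mapping.keys c.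
        I +>\<^bsub>free_algebra\<^esub> fscale (Poly_Mapping.lookup c e) (word (inv_into N b e)))"
      by (intro Q.finsum_cong') (simp_all add: carrier_quotient_algebra)
    then show ?thesis
      by (simp add: lift_def finsum_quotient_algebra[OF I])
  qed
  show "is_basis ?Q ((\<lambda>w. I +>\<^bsub>free_algebra\<^esub> word w) ` N)"
    unfolding is_basis_def b_def[symmetric]
  proof (intro conjI ballI)
    show "b ` N \<subseteq> carrier ?Q" by (auto simp: b_def carrier_quotient_algebra)
  next
    fix v assume "v \<in> carrier ?Q"
    then obtain f where f: "v = I +>\<^bsub>free_algebra\<^esub> f" by (auto simp: carrier_quotient_algebra)
    obtain g where g: "Poly_Mapping.keys g \<subseteq> N" "f - g \<in> I" using nf by blast
    define c where "c = (\<Sum>w\<in>Poly_Mapping.keys g. Poly_Mapping.single (b w) (Poly_Mapping.lookup g w))"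
    have "Poly_Mapping.keys c \<subseteq> (\<Union>w\<in>Poly_Mapping.keys g. Poly_Mapping.keys (Poly_Mapping.single (b w) (Poly_Mapping.lookup g w)))"
      unfolding c_def by (rule keys_sum)
    then have keys_c: "Poly_Mapping.keys c \<subseteq> b ` N"
      using g(1) by (auto split: if_splits)
    have lookup_c: "Poly_Mapping.lookup c (b w) = Poly_Mapping.lookup g w" if "w \<in> N" for w
    proof -
      have "Poly_Mapping.lookup c (b w) =
          (\<Sum>w'\<in>Poly_Mapping.keys g. if w' = w then Poly_Mapping.lookup g w' else 0)"
        unfolding c_def lookup_sum using that g(1) inj
        by (intro sum.cong) (auto simp: lookup_single when_def inj_on_eq_iff)
      then show ?thesis by (simp add: in_keys_iff)
    qed
    have lift_c: "lift c = g"
    proof (rule poly_mapping_eqI)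
      fix w
      show "Poly_Mapping.lookup (lift c) w = Poly_Mapping.lookup g w"
      proof (cases "w \<in> N")
        case True
        then show ?thesis by (simp add: lookup_lift[OF keys_c] lookup_c)
      next
        case False
        then show ?thesis using keys_lift[OF keys_c] g(1) by (metis in_keys_iff subsetD)
      qed
    qed
    have uniq: "c' = c" if c': "Poly_Mapping.keys c' \<subseteq> b ` N" "v = I +>\<^bsub>free_algebra\<^esub> lift c'" for c'
    proof -
      have "f - lift c' \<in> I" using c'(2) f by (simp add: coset_eq_iff[OF I])
      then have "lift c' - g \<in> I"
        using g(2) ideal_subspace[OF I] subspace_cong_trans subspace_cong_sym by metis
      then have "lift c' - g = 0"
        using g(1) keys_lift[OF c'(1)] by (intro indep keys_diff_subset)
      then have eq: "lift c' = g" by simp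
      show ?thesis
      proof (rule poly_mapping_eqI)
        fix e
        show "Poly_Mapping.lookup c' e = Poly_Mapping.lookup c e"
        proof (cases "e \<in> b ` N")
          case True
          then show ?thesis using lookup_lift[OF c'(1)] lookup_c eq by auto
        next
          case False
          then show ?thesis using c'(1) keys_c by (metis in_keys_iff subsetD)
        qed
      qed
    qed
    show "\<exists>!c. Poly_Mapping.keys c \<subseteq> b ` N \<and>
        v = (\<Oplus>\<^bsub>?Q\<^esub>e\<in>Poly_Mapping.keys c. Poly_Mapping.lookup c e \<odot>\<^bsub>?Q\<^esub> e)"
    proof (rule ex1I[of _ c])
      show "Poly_Mapping.keys c \<subseteq> b ` N \<and> v = (\<Oplus>\<^bsub>?Q\<^esub>e\<in>Poly_Mapping.keys c. Poly_Mapping.lookup c e \<odot>\<^bsub>?Q\<^esub> e)"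
        using keys_c finsum[OF keys_c] g(2) f by (simp add: lift_c coset_eq_iff[OF I])
    qed (use uniq finsum in auto)
  qed
qed

lemma algebra_relationsI:
  shows "word [\<iota> (x + y)] - (word [\<iota> x] + word [\<iota> y]) \<in> algebra_relations scale \<iota>"
    and "word [\<iota> (scale a x)] - fscale a (word [\<iota> x]) \<in> algebra_relations scale \<iota>"
    and "word [\<iota> (x * y)] - word [\<iota> x] * word [\<iota> y] \<in> algebra_relations scale \<iota>"
    and "word [\<iota> 1] - 1 \<in> algebra_relations scale \<iota>"
  unfolding algebra_relations_def by blast+

section \<open>The defining relations of one factor against its reductions\<close>

context inner_inverse_half
begin

text \<open>The unit relation settles the basis element 1, other basis elements are their own
  expansions, and the additive and scalar relations carry the claim along the span.\<close>

lemma letter_cong_ex: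
  assumes "free_alg.subspace V" "algebra_relations scale \<iota> \<subseteq> V"
  shows "word [\<iota> r] - ex r \<in> V"
proof -
  note rel = algebra_relationsI[where scale = scale and \<iota> = \<iota>, THEN subsetD[OF assms(2)]]
  have "r \<in> span (insert 1 B)" by (simp add: span_insert_one)
  then show ?thesis
  proof (induction rule: span_induct_alt)
    case base
    show ?case using rel(2)[of 0 0] by (simp add: ex_zero)
  next
    case (step c x y)
    have x: "word [\<iota> x] - ex x \<in> V"
      using step(1) rel(4) free_alg.subspace_0[OF assms(1)] by (auto simp: ex_letter)
    have "(word [\<iota> (scale c x + y)] - (word [\<iota> (scale c x)] + word [\<iota> y])) +
        ((word [\<iota> (scale c x)] - fscale c (word [\<iota> x])) + (fscale c (word [\<iota> x] - ex x) + (word [\<iota> y] - ex y))) \<in> V"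
      by (intro free_alg.subspace_add[OF assms(1)] free_alg.subspace_scale[OF assms(1)] rel x step)
    then show ?case
      by (simp add: ex_add ex_scale free_alg.scale_right_diff_distrib algebra_simps)
  qed
qed

text \<open>An inner reduction is the relation pqp = p multiplied by x on the left and y on the
  right: (xp) q (py) = x (pqp) y = xpy.\<close>

lemma \<Sigma>_cong:
  assumes I: "ideal V free_algebra" and rel: "algebra_relations scale \<iota> \<subseteq> V"
    and pqp: "word [\<iota> p] * word [q'] * word [\<iota> p] - word [\<iota> p] \<in> V"
    and "(W, h) \<in> \<Sigma>"
  shows "word W - h \<in> V"
proof -
  note sub = ideal_subspace[OF I]
  note tr = subspace_cong_trans[OF sub] and sym = subspace_cong_sym[OF sub]
  have refl: "f - f \<in> V" for f using free_alg.subspace_0[OF sub] by simp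
  note mult = algebra_relationsI(3)[THEN subsetD[OF rel]]
  have ex: "word [\<iota> r] - ex r \<in> V" for r
    by (rule letter_cong_ex[OF sub rel])
  from assms(4) show ?thesis
  proof (cases rule: \<Sigma>_cases)
    case (prod x y)
    have "word W = word [\<iota> x] * word [\<iota> y]" by (simp add: prod flip: word_append)
    show ?thesis
      unfolding prod(4) \<open>word W = _\<close> by (rule tr[OF sym[OF mult] ex])
  next
    case (inner x y)
    let ?p = "word [\<iota> p]" and ?x = "word [\<iota> x]" and ?y = "word [\<iota> y]"
    have "word W = word [\<iota> (x * p)] * word [q'] * word [\<iota> (p * y)]"
      by (simp add: inner flip: word_append)
    moreover have "word [\<iota> (x * p)] * word [q'] * word [\<iota> (p * y)] - (?x * ?p) * word [q'] * (?p * ?y) \<in> V"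
      by (intro ideal_cong_mult[OF I] mult refl)
    moreover have "?x * (?p * word [q'] * ?p) * ?y - ?x * ?p * ?y \<in> V"
      by (intro ideal_cong_mult[OF I] pqp refl)
    moreover have "?x * ?p * ?y - word [\<iota> (x * p * y)] \<in> V"
      by (rule sym[OF tr[OF mult ideal_cong_mult[OF I mult refl]]])
    ultimately have "word W - word [\<iota> (x * p * y)] \<in> V"
      by (metis (no_types, lifting) mult.assoc tr)
    then show ?thesis using tr ex inner by blast
  qed
qed

text \<open>The converse direction: reductions between letters already force the multiplication
  table of the whole algebra, by bilinearity.\<close>

lemma ex_mult_cong:
  assumes V: "free_alg.subspace V" and \<Sigma>: "\<And>W h. (W, h) \<in> \<Sigma> \<Longrightarrow> word W - h \<in> V"
  shows "ex x * ex y - ex (x * y) \<in> V"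
proof -
  have letters: "ex b * ex c - ex (b * c) \<in> V" if "b \<in> insert 1 B" "c \<in> insert 1 B" for b c
  proof (cases "b = 1 \<or> c = 1")
    case True
    then show ?thesis using free_alg.subspace_0[OF V] by auto
  next
    case False
    then show ?thesis
      using that \<Sigma>[OF \<Sigma>_prod, of b c] by (auto simp: ex_letter simp flip: word_append)
  qed
  have left: "ex x * ex c - ex (x * c) \<in> V" if "c \<in> insert 1 B" for c
    by (rule linear_in_subspace[where f = "\<lambda>x. ex x * ex c - ex (x * c)" and A = "insert 1 B", OF V])
       (use that in \<open>auto simp: span_insert_one bilinear_simps intro: letters\<close>)
  show ?thesis
    by (rule linear_in_subspace[where f = "\<lambda>y. ex x * ex y - ex (x * y)" and A = "insert 1 B", OF V])
       (auto simp: span_insert_one bilinear_simps intro: left)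
qed

text \<open>The case x = y = 1 of an inner reduction, available because p itself belongs to
  \<open>Bpp\<close>.\<close>

lemma \<Sigma>_pqp: "([\<iota> p, q', \<iota> p], word [\<iota> p]) \<in> \<Sigma>"
  using \<Sigma>_inner[of 1 1] p_in ex_letter[of p] by simp

lemma keys_ex_lists:
  assumes "\<iota> ` B \<subseteq> A"
  shows "Poly_Mapping.keys (ex r) \<subseteq> lists A"
proof -
  have "[\<iota> b] \<in> lists A" if "b \<in> B" for b
    using subsetD[OF assms imageI[OF that]] by simp
  then have "insert [] ((\<lambda>b. [\<iota> b]) ` B) \<subseteq> lists A"
    unfolding insert_subset image_subset_iff using lists.Nil by blast
  then show ?thesis by (rule order_trans[OF keys_ex])
qed

lemma \<Sigma>_keys_lists:
  assumes "(W, h) \<in> \<Sigma>" "\<iota> ` B \<subseteq> A"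
  shows "Poly_Mapping.keys h \<subseteq> lists A"
  using assms(1) keys_ex_lists[OF assms(2)] by (elim \<Sigma>_cases) simp_all

end

section \<open>Both factors together\<close>

text \<open>The embeddings stay abstract so that the situation is symmetric: \<open>swap\<close>
  exchanges the factors, and each mixed case is treated in one order only.\<close>

locale inner_inverse_pair =
  one: inner_inverse_half sc1 p1 Bpp Bpm Bmp Bmm \<iota>1 "\<iota>2 p2" +
  two: inner_inverse_half sc2 p2 Cpp Cpm Cmp Cmm \<iota>2 "\<iota>1 p1"
  for sc1 :: "'k::field \<Rightarrow> 'r::ring_1 \<Rightarrow> 'r" and p1 Bpp Bpm Bmp Bmm and \<iota>1 :: "'r \<Rightarrow> 'g"
    and sc2 :: "'k \<Rightarrow> 's::ring_1 \<Rightarrow> 's" and p2 Cpp Cpm Cmp Cmm and \<iota>2 :: "'s \<Rightarrow> 'g" +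
  assumes disjoint: "range \<iota>1 \<inter> range \<iota>2 = {}"
begin

lemma swap: "inner_inverse_pair sc2 p2 Cpp Cpm Cmp Cmm \<iota>2 sc1 p1 Bpp Bpm Bmp Bmm \<iota>1"
  by (intro inner_inverse_pair.intro inner_inverse_pair_axioms.intro one.inner_inverse_half_axioms
      two.inner_inverse_half_axioms) (use disjoint in blast)

lemma \<iota>_neq: "\<iota>1 x \<noteq> \<iota>2 y" "\<iota>2 y \<noteq> \<iota>1 x"
  using disjoint by (blast, metis IntI disjoint empty_iff rangeI)

text \<open>A left-hand side begins and ends with letters of its own factor and has at least two
  letters, while one of the other factor contains at most one such letter.\<close>

lemma cross_no_inclusion:
  assumes "(W, h) \<in> one.\<Sigma>" "(a @ W @ b, h') \<in> two.\<Sigma>"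
  shows False
  using assms(1)
proof (cases rule: one.\<Sigma>_cases)
  case (prod x y)
  note W = prod(3)
  from assms(2) show ?thesis
  proof (cases rule: two.\<Sigma>_cases)
    case (prod x' y')
    from this(3) show ?thesis by (auto simp: W append_eq_Cons_conv \<iota>_neq)
  next
    case (inner x' y')
    from this(3) show ?thesis by (auto simp: W append_eq_Cons_conv \<iota>_neq)
  qed
next
  case (inner x y)
  note W = inner(3)
  from assms(2) show ?thesis
  proof (cases rule: two.\<Sigma>_cases)
    case (prod x' y')
    from arg_cong[OF this(3), of length] show ?thesis by (simp add: W)
  next
    case (inner x' y')
    from this(3) show ?thesis by (auto simp: W append_eq_Cons_conv \<iota>_neq)
  qed
qed

text \<open>The only ambiguity is \<open>(xp) q p (qy)\<close>, which both reductions take to \<open>(xp) (qy)\<close>.\<close>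

lemma cross_overlap:
  assumes "(a @ b, h) \<in> one.\<Sigma>" "(b @ c, h') \<in> two.\<Sigma>" and ne: "a \<noteq> []" "b \<noteq> []" "c \<noteq> []"
  shows "h * word c = word a * h'"
  using assms(1)
proof (cases rule: one.\<Sigma>_cases)
  case (prod x y)
  from append_eq_two[OF this(3) ne(1,2)] have b: "b = [\<iota>1 y]" by simp
  from assms(2) show ?thesis
    by (cases rule: two.\<Sigma>_cases) (simp_all add: b \<iota>_neq)
next
  case 1: (inner x y)
  from assms(2) show ?thesis
  proof (cases rule: two.\<Sigma>_cases)
    case (prod x' y')
    from append_eq_two[OF this(3) ne(2,3)] append_eq_three[OF 1(3) ne(1,2)] show ?thesis by (auto simp: \<iota>_neq)
  next
    case 2: (inner x' y')
    \<comment> \<open>The overlap is the two-letter word q p. Comparing letters forces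
      \<open>p1 * y = p1\<close> and \<open>x' * p2 = p2\<close>, so each right-hand side is the
      expansion of a single letter.\<close>
    from append_eq_three[OF 2(3) ne(2,3)] append_eq_three[OF 1(3) ne(1,2)]
    have abc: "a = [\<iota>1 (x * p1)]" "c = [\<iota>2 (p2 * y')]" "p1 * y = p1" "x' * p2 = p2"
      by (auto simp: \<iota>_neq inj_eq[OF one.inj] inj_eq[OF two.inj])
    have "h = word a"
      using 1 abc one.ex_letter[of "x * p1"] by (auto simp: mult.assoc)
    moreover have "h' = word c"
      using 2 abc two.ex_letter[of "p2 * y'"] by auto
    ultimately show ?thesis by simp
  qed
qed

sublocale confluent "one.\<Sigma> \<union> two.\<Sigma>"
proof
  interpret swapped: inner_inverse_pair sc2 p2 Cpp Cpm Cmp Cmm \<iota>2 sc1 p1 Bpp Bpm Bmp Bmm \<iota>1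
    by (rule swap)
  let ?S = "one.\<Sigma> \<union> two.\<Sigma>"
  show "length w < length W" if "(W, h) \<in> ?S" "w \<in> Poly_Mapping.keys h" for W h w
    using that one.\<Sigma>_shorter two.\<Sigma>_shorter by blast
  show "a = [] \<and> b = [] \<and> h = h'" if "(W, h) \<in> ?S" "(a @ W @ b, h') \<in> ?S" for W h a b h'
    using that one.\<Sigma>_no_inclusion two.\<Sigma>_no_inclusion cross_no_inclusion swapped.cross_no_inclusion by blast
  fix a b c h h'
  assume ab: "(a @ b, h) \<in> ?S" and bc: "(b @ c, h') \<in> ?S" and ne: "a \<noteq> []" "b \<noteq> []" "c \<noteq> []"
  consider "(a @ b, h) \<in> one.\<Sigma>" "(b @ c, h') \<in> one.\<Sigma>" | "(a @ b, h) \<in> two.\<Sigma>" "(b @ c, h') \<in> two.\<Sigma>"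
    | "h * word c = word a * h'"
    using ab bc cross_overlap[OF _ _ ne] swapped.cross_overlap[OF _ _ ne] by blast
  then show "h * word c - word a * h' \<in> rel_below ?S (length (a @ b @ c))"
  proof cases
    case 1
    from one.\<Sigma>_overlap[OF 1 ne] show ?thesis
      using rel_below_mono[of one.\<Sigma> ?S] by blast
  next
    case 2
    from two.\<Sigma>_overlap[OF 2 ne] show ?thesis
      using rel_below_mono[of two.\<Sigma> ?S] by blast
  qed (simp add: free_alg.span_zero)
qed

end

section \<open>The algebra \<open>T\<close>: spanning, independence and reduction of normal
  words\<close>

locale universal_inner_inverses =
  inner_inverse_pair scR p Bpp Bpm Bmp Bmm "Inl :: 'r \<Rightarrow> 'r + 's" scS q Cpp Cpm Cmp Cmm Inr
  for scR :: "'k::field \<Rightarrow> 'r::ring_1 \<Rightarrow> 'r" and p Bpp Bpm Bmp Bmm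
    and scS :: "'k \<Rightarrow> 's::ring_1 \<Rightarrow> 's" and q Cpp Cpm Cmp Cmm
begin

abbreviation G :: "('r + 's) set" where
  "G \<equiv> Inl ` one.B \<union> Inr ` two.B"

abbreviation I :: "('r + 's, 'k) free_alg set" where
  "I \<equiv> T_ideal scR scS p q"

abbreviation N :: "('r + 's) list set" where
  "N \<equiv> normal_words G (forbidden Inl (Inr q) Bpp Bpm Bmp Bmm \<union> forbidden Inr (Inl p) Cpp Cpm Cmp Cmm)"

abbreviation \<Sigma> :: "(('r + 's) list \<times> ('r + 's, 'k) free_alg) set" where
  "\<Sigma> \<equiv> one.\<Sigma> \<union> two.\<Sigma>"

lemma N_eq: "N = lists G \<inter> {w. irreducible \<Sigma> w}"
  unfolding normal_words_def irreducible_def image_Un one.fst_\<Sigma> two.fst_\<Sigma> by blast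

abbreviation relations :: "('r + 's, 'k) free_alg set" where
  "relations \<equiv> algebra_relations scR Inl \<union> algebra_relations scS Inr \<union>
    {word [Inl p] * word [Inr q] * word [Inl p] - word [Inl p],
     word [Inr q] * word [Inl p] * word [Inr q] - word [Inr q]}"

lemma ideal_I: "ideal I free_algebra"
  unfolding T_ideal_def by (rule ring.genideal_ideal[OF ring_free_algebra]) simp

lemma relations_in_I: "relations \<subseteq> I"
  unfolding T_ideal_def by (rule ring.genideal_self[OF ring_free_algebra]) simp

lemma I_minimal: "ideal V free_algebra \<Longrightarrow> relations \<subseteq> V \<Longrightarrow> I \<subseteq> V"
  unfolding T_ideal_def by (rule ring.genideal_minimal[OF ring_free_algebra])

lemma \<Sigma>_cong_I:
  assumes "(W, h) \<in> \<Sigma>"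
  shows "word W - h \<in> I"
  using assms relations_in_I one.\<Sigma>_cong[OF ideal_I] two.\<Sigma>_cong[OF ideal_I] by auto

lemma rewrites_to_cong_I:
  assumes "rewrites_to \<Sigma> w f"
  shows "word w - f \<in> I"
proof -
  obtain u W h v where *: "(W, h) \<in> \<Sigma>" "w = u @ W @ v" "f = word u * h * word v"
    using assms unfolding rewrites_to_def by blast
  have "word u * (word W - h) * word v \<in> I"
    by (intro ideal_mult[OF ideal_I] \<Sigma>_cong_I *(1))
  then show ?thesis by (simp add: * word_append algebra_simps)
qed

lemma rewrites_to_keys:
  assumes "rewrites_to \<Sigma> w f" "w \<in> lists G"
  shows "Poly_Mapping.keys f \<subseteq> lists G"
proof -
  obtain u W h v where *: "(W, h) \<in> \<Sigma>" "w = u @ W @ v" "f = word u * h * word v"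
    using assms unfolding rewrites_to_def by blast
  have "Poly_Mapping.keys h \<subseteq> lists G"
    using *(1) one.\<Sigma>_keys_lists[OF _ Un_upper1] two.\<Sigma>_keys_lists[OF _ Un_upper2] by blast
  moreover have "Poly_Mapping.keys (word u :: ('r + 's, 'k) free_alg) \<subseteq> lists G"
    "Poly_Mapping.keys (word v :: ('r + 's, 'k) free_alg) \<subseteq> lists G"
    using assms(2) unfolding *(2) append_in_lists_conv keys_word by blast+
  ultimately show ?thesis
    unfolding *(3) by (intro keys_mult_lists)
qed

text \<open>
  Every element of \<open>R\<close> and \<open>S\<close> is a generator of the presentation; \<open>subst\<close> rewrites
  them all in terms of the basis letters.
\<close>

definition letter :: "'r + 's \<Rightarrow> ('r + 's, 'k) free_alg" where
  "letter g = (case g of Inl x \<Rightarrow> one.ex x | Inr y \<Rightarrow> two.ex y)"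

abbreviation subst :: "('r + 's, 'k) free_alg \<Rightarrow> ('r + 's, 'k) free_alg" where
  "subst \<equiv> lin (\<lambda>w. prod_list (map letter w))"

lemma letter_simps [simp]: "letter (Inl x) = one.ex x" "letter (Inr y) = two.ex y"
  by (simp_all add: letter_def)

lemma subst_mult [simp]: "subst (f * g) = subst f * subst g"
proof -
  have "subst (word u * word v) = subst (word u) * subst (word v)" for u v
    by (simp flip: word_append)
  then have "subst (word u * g) = subst (word u) * subst g" for u
    by (induction g rule: free_alg_induct) (auto simp: distrib_left fscale_mult_right)
  then show ?thesis
    by (induction f rule: free_alg_induct) (auto simp: distrib_right fscale_mult_left)
qed

lemma letter_cong_I: "word [g] - letter g \<in> I"
  using relations_in_I one.letter_cong_ex[OF ideal_subspace[OF ideal_I]]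
    two.letter_cong_ex[OF ideal_subspace[OF ideal_I]]
  by (cases g) auto

text \<open>Substitution does not change the class modulo \<open>I\<close>, so every class has a
  representative in basis letters.\<close>

lemma subst_cong_I: "f - subst f \<in> I"
proof (induction f rule: free_alg_induct)
  case (word w)
  show ?case
  proof (induction w)
    case Nil
    then show ?case by (simp add: word_Nil free_alg.subspace_0[OF ideal_subspace[OF ideal_I]])
  next
    case (Cons g w)
    from ideal_cong_mult[OF ideal_I letter_cong_I Cons] show ?case
      by (simp flip: word_append)
  qed
next
  case (add f g)
  from free_alg.subspace_add[OF ideal_subspace[OF ideal_I] this] show ?case
    by (simp add: algebra_simps)
next
  case (scale a f)
  from free_alg.subspace_scale[OF ideal_subspace[OF ideal_I] this] show ?case
    by (simp add: free_alg.scale_right_diff_distrib)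
qed (simp add: free_alg.subspace_0[OF ideal_subspace[OF ideal_I]])

lemma keys_letter: "Poly_Mapping.keys (letter g) \<subseteq> lists G"
  by (cases g) (simp_all only: letter_simps one.keys_ex_lists[OF Un_upper1] two.keys_ex_lists[OF Un_upper2])

lemma keys_subst: "Poly_Mapping.keys (subst f) \<subseteq> lists G"
proof (rule keys_lin)
  fix w
  show "Poly_Mapping.keys (prod_list (map letter w)) \<subseteq> lists G"
  proof (induction w)
    case (Cons g w)
    then show ?case using keys_mult_lists[OF keys_letter[of g]] by simp
  qed (simp flip: word_Nil)
qed

lemma subst_basis_words:
  assumes "Poly_Mapping.keys f \<subseteq> lists G"
  shows "subst f = f"
  using assms
proof (induction f rule: free_alg_keys_induct)
  case (word w)
  then show ?case
  proof (induction w)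
    case (Cons g w)
    then have "letter g = word [g]" by (auto simp: one.ex_letter two.ex_letter)
    then show ?case using Cons by (auto simp flip: word_append)
  qed (simp add: word_Nil)
qed auto

text \<open>Since \<open>nf\<close> is not multiplicative, its kernel is not visibly an ideal. The
  proof uses the largest two-sided ideal \<open>Z\<close> inside that kernel and its preimage
  \<open>V\<close> under the multiplicative map \<open>subst\<close>; the minimality of
  \<open>I\<close> then puts it inside \<open>V\<close>.\<close>

lemma nf_subst_I:
  assumes "f \<in> I"
  shows "nf (subst f) = 0"
proof -
  define Z where "Z = {f. \<forall>a b. nf (a * f * b) = 0}"
  have Z: "free_alg.subspace Z"
    unfolding Z_def
    by (rule free_alg.subspaceI) (auto simp: distrib_left distrib_right fscale_mult_left fscale_mult_right)
  have rel: "word W - h \<in> Z" if "(W, h) \<in> \<Sigma>" for W h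
    using nf_relator[OF that] by (simp add: Z_def left_diff_distrib right_diff_distrib)
  define V where "V = {f. subst f \<in> Z}"
  have "ideal V free_algebra"
  proof (rule ideal_free_algebraI)
    show "free_alg.subspace V"
      unfolding V_def using Z
      by (intro free_alg.subspaceI) (auto simp: free_alg.subspace_0 free_alg.subspace_add free_alg.subspace_scale)
    fix f g assume g: "g \<in> V"
    show "f * g \<in> V" using g by (auto simp: V_def Z_def simp flip: mult.assoc)
    have "nf (a * (subst g * subst f) * b) = nf (a * subst g * (subst f * b))" for a b
      by (simp add: mult.assoc)
    then show "g * f \<in> V" using g by (simp add: V_def Z_def)
  qed
  moreover have "relations \<subseteq> V"
  proof -
    note zero = free_alg.subspace_0[OF Z]
    \<comment> \<open>Only the multiplicative and the inner-inverse relations need reductions;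
      \<open>subst\<close> maps the additive, scalar and unit relations to 0.\<close>
    have "one.ex (x * y) - one.ex x * one.ex y \<in> Z" for x y
      using subspace_cong_sym[OF Z one.ex_mult_cong[OF Z]] rel by blast
    moreover have "two.ex (x * y) - two.ex x * two.ex y \<in> Z" for x y
      using subspace_cong_sym[OF Z two.ex_mult_cong[OF Z]] rel by blast
    moreover have "word [Inl p, Inr q, Inl p] - word [Inl p] \<in> Z"
      "word [Inr q, Inl p, Inr q] - word [Inr q] \<in> Z"
      using rel one.\<Sigma>_pqp two.\<Sigma>_pqp by auto
    moreover have "one.ex p = word [Inl p]" "two.ex q = word [Inr q]"
      using one.p_in two.p_in by (simp_all add: one.ex_letter two.ex_letter)
    ultimately show ?thesis
      by (auto simp: V_def algebra_relations_def one.ex_add two.ex_add one.ex_scale two.ex_scale zero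
          simp flip: word_append mult.assoc)
  qed
  ultimately have "f \<in> V" using assms I_minimal by blast
  then have "nf (1 * subst f * 1) = 0" unfolding V_def Z_def by blast
  then show ?thesis by simp
qed

text \<open>Substitution has to come first: rewriting keeps words within the basis letters, but an
  irreducible word containing other generators is not a normal word.\<close>

lemma normal_form:
  shows "Poly_Mapping.keys (nf (subst f)) \<subseteq> N" and "f - nf (subst f) \<in> I"
proof -
  have *: "Poly_Mapping.keys (nf (subst f)) \<subseteq> lists G \<and> subst f - nf (subst f) \<in> I"
    by (rule nf_induct)
       (use keys_subst rewrites_to_keys rewrites_to_cong_I ideal_subspace[OF ideal_I] in blast)+
  then show "Poly_Mapping.keys (nf (subst f)) \<subseteq> N"
    using keys_nf unfolding N_eq by blast
  show "f - nf (subst f) \<in> I"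
    using subspace_cong_trans[OF ideal_subspace[OF ideal_I] subst_cong_I] * by blast
qed

lemma normal_independent:
  assumes "Poly_Mapping.keys f \<subseteq> N" "f \<in> I"
  shows "f = 0"
proof -
  have "nf (subst f) = f"
    using assms(1) by (simp add: N_eq subst_basis_words nf_irreducible)
  then show ?thesis using nf_subst_I[OF assms(2)] by simp
qed

lemma red_step_cong:
  assumes "red_step \<Sigma> f g"
  shows "f - g \<in> I" and "f \<in> free_on G \<Longrightarrow> g \<in> free_on G"
proof -
  obtain w h where w: "w \<in> Poly_Mapping.keys f" "rewrites_to \<Sigma> w h"
    and g: "g = f - fscale (Poly_Mapping.lookup f w) (word w - h)"
    using assms unfolding red_step_iff by blast
  show "f - g \<in> I"
    using free_alg.subspace_scale[OF ideal_subspace[OF ideal_I] rewrites_to_cong_I[OF w(2)]]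
    by (simp add: g)
  assume "f \<in> free_on G"
  then have "Poly_Mapping.keys f \<subseteq> lists G" "w \<in> lists G" using w(1) by (auto simp: free_on_def)
  then show "g \<in> free_on G"
    unfolding g free_on_def mem_Collect_eq using rewrites_to_keys[OF w(2)]
    by (intro keys_diff_subset order_trans[OF keys_fscale]) auto
qed

lemma red_steps_cong:
  assumes "(red_step \<Sigma>)\<^sup>*\<^sup>* f g" "f \<in> free_on G"
  shows "f - g \<in> I \<and> g \<in> free_on G"
  using assms
proof (induction rule: rtranclp_induct)
  case base
  then show ?case by (simp add: free_alg.subspace_0[OF ideal_subspace[OF ideal_I]])
next
  case (step g h)
  then show ?case
    using red_step_cong[OF step(2)] subspace_cong_trans[OF ideal_subspace[OF ideal_I]] by blast
qed

text \<open>The endpoint of any sequence of steps is a combination of normal words in the class of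
  \<open>f\<close>. Independence of normal words makes it unique, whichever steps were
  chosen.\<close>

lemma reduces_to_normal_form:
  "reduces_to_normal_form (\<lambda>f. I +>\<^bsub>free_algebra\<^esub> f) G N \<Sigma>"
  unfolding reduces_to_normal_form_def coset_eq_iff[OF ideal_I]
proof (intro conjI ballI allI impI)
  show "case x of (W, h) \<Rightarrow> word W - h \<in> I" if "x \<in> \<Sigma>" for x
    using that \<Sigma>_cong_I by (cases x) simp
  fix f :: "('r + 's, 'k) free_alg" assume f: "f \<in> free_on G"
  show "\<not> (\<exists>F. F 0 = f \<and> (\<forall>i. red_step \<Sigma> (F i) (F (Suc i))))"
    by (rule red_step_terminates)
  show "\<exists>!g. Poly_Mapping.keys g \<subseteq> N \<and> g - f \<in> I"
  proof (rule ex1I[of _ "nf (subst f)"])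
    show "Poly_Mapping.keys (nf (subst f)) \<subseteq> N \<and> nf (subst f) - f \<in> I"
      using normal_form subspace_cong_sym[OF ideal_subspace[OF ideal_I]] by blast
    fix g assume g: "Poly_Mapping.keys g \<subseteq> N \<and> g - f \<in> I"
    have "g - nf (subst f) = 0"
      using g normal_form subspace_cong_trans[OF ideal_subspace[OF ideal_I], of g f]
      by (intro normal_independent keys_diff_subset) blast+
    then show "g = nf (subst f)" by simp
  qed
  fix h assume h: "(red_step \<Sigma>)\<^sup>*\<^sup>* f h \<and> \<not> (\<exists>h'. red_step \<Sigma> h h')"
  then have cong: "f - h \<in> I" "h \<in> free_on G"
    using red_steps_cong f by blast+
  then show "h - f \<in> I"
    using subspace_cong_sym[OF ideal_subspace[OF ideal_I]] by blast
  \<comment> \<open>A reducible word in the support would permit a further step.\<close>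
  have "irreducible \<Sigma> w" if "w \<in> Poly_Mapping.keys h" for w
    using h that not_irreducible_iff[of \<Sigma> w] unfolding red_step_iff by blast
  then show "Poly_Mapping.keys h \<subseteq> N"
    using cong(2) by (auto simp: N_eq free_on_def)
qed

end

theorem theorem18:
  fixes scR :: "'k::field \<Rightarrow> 'r::ring_1 \<Rightarrow> 'r"
    and scS :: "'k \<Rightarrow> 's::ring_1 \<Rightarrow> 's"
    and p :: 'r and q :: 's
    and Bpp Bpm Bmp Bmm :: "'r set"
    and Cpp Cpm Cmp Cmm :: "'s set"
  assumes "k_algebra scR" and "k_algebra scS"
    and "p \<noteq> 0" and "q \<noteq> 0"
    and "1 \<notin> right_multiples p + left_multiples p"
    and "1 \<notin> right_multiples q + left_multiples q"
    and "adapted_basis scR p Bpp Bpm Bmp Bmm"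
    and "adapted_basis scS q Cpp Cpm Cmp Cmm"
  shows
    "let B = Bpp \<union> Bpm \<union> Bmp \<union> Bmm;
         C = Cpp \<union> Cpm \<union> Cmp \<union> Cmm;
         G = Inl ` B \<union> Inr ` C;
         T = T_algebra scR scS p q;
         \<pi> = T_map scR scS p q;
         N = normal_words G
               (forbidden Inl (Inr q) Bpp Bpm Bmp Bmm \<union>
                forbidden Inr (Inl p) Cpp Cpm Cmp Cmm);
         \<Sigma> = reductions scR Inl p (Inr q) Bpp Bpm Bmp Bmm \<union>
             reductions scS Inr q (Inl p) Cpp Cpm Cmp Cmm
     in relative_basis scR {0} UNIV (insert 1 B) \<and>
        relative_basis scS {0} UNIV (insert 1 C) \<and>
        inj_on (\<lambda>w. \<pi> (word w)) N \<and> is_basis T ((\<lambda>w. \<pi> (word w)) ` N) \<and>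
        reduces_to_normal_form \<pi> G N \<Sigma>"
proof -
  interpret universal_inner_inverses scR p Bpp Bpm Bmp Bmm scS q Cpp Cpm Cmp Cmm
    by (intro universal_inner_inverses.intro inner_inverse_pair.intro inner_inverse_pair_axioms.intro
        inner_inverse_half.intro inner_inverse_half_axioms.intro assms) auto
  have nf: "\<exists>g. Poly_Mapping.keys g \<subseteq> N \<and> f - g \<in> I" for f
    using normal_form by blast
  show ?thesis
    unfolding Let_def T_algebra_def T_map_def[abs_def]
    using one.basis_insert_one two.basis_insert_one reduces_to_normal_form
      quotient_basis[OF ideal_I nf normal_independent] by blast
qed

end
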